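(* Let $m,n>-1/2$, $\alpha_1,\alpha_2>0$ and $0\le|\beta_i|<\alpha_i$ for $i=1,2$. Let $X\sim\mathrm{VG}(m,\alpha_1,\beta_1,0)$ and $Y\sim\mathrm{VG}(n,\alpha_2,\beta_2,0)$ be independent and let $Z=XY$. Then for all $z\in\mathbb{R}$ with $z\neq 0$, \[ f_Z(z)=\frac{\gamma_1^{2m+1}\gamma_2^{2n+1}}{4\pi\alpha_1^{2m}\alpha_2^{2n}\Gamma(m+1/2)\Gamma(n+1/2)}\sum_{i=0}^\infty\sum_{j=0}^{2i}\frac{(\mathrm{sgn}(z))^j}{j!\,(2i-j)!}\Big(\frac{2\beta_1}{\alpha_1}\Big)^j\Big(\frac{2\beta_2}{\alpha_2}\Big)^{2i-j}G^{4,0}_{0,4}\bigg(\frac{\alpha_1^2\alpha_2^2}{16}z^2\,\bigg|\,{-\atop \frac{j}{2},\,i-\frac{j}{2},\,m+\frac{j}{2},\,n+i-\frac{j}{2}}\bigg). \]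
   Context: For $\mu>-1/2$, $\alpha>0$ and $0\le|\beta|<\alpha$, $\mathrm{VG}(\mu,\alpha,\beta,0)$ denotes the variance-gamma distribution on $\mathbb{R}$ with probability density function $f(x)=\frac{(\alpha^2-\beta^2)^{\mu+1/2}}{\sqrt{\pi}(2\alpha)^{\mu}\Gamma(\mu+1/2)}e^{\beta x}|x|^{\mu}K_{\mu}(\alpha|x|)$, where $K_\nu$ is the modified Bessel function of the second kind. Notation: $\gamma_i=\sqrt{\alpha_i^2-\beta_i^2}$, $\lambda_i^{\pm}=\alpha_i\pm\beta_i$ ($i=1,2$); $f_Z$ is the density of $Z$; $\mathrm{sgn}(z)$ is the sign function with $\mathrm{sgn}(0)=0$. The Meijer $G$-function is defined by $G^{k,l}_{p,q}\big(x\,\big|\,{a_1,\dots,a_p\atop b_1,\dots,b_q}\big)=\frac{1}{2\pi\mathrm{i}}\int_L\frac{\prod_{j=1}^k\Gamma(b_j-s)\prod_{j=1}^l\Gamma(1-a_j+s)}{\prod_{j=l+1}^p\Gamma(a_j-s)\prod_{j=k+1}^q\Gamma(1-b_j+s)}x^s\,\mathrm{d}s$, where the path $L$ separates the poles of the $\Gamma(b_j-s)$ from those of the $\Gamma(1-a_j+s)$, empty products are $1$, and "$-$" denotes an empty list of upper parameters. *)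

theory Defs
  imports "HOL-Probability.Probability"
begin

text \<open>Modified Bessel function of the second kind, via the standard integral
  representation  K_nu(x) = int_0^infty exp(-x cosh t) cosh(nu t) dt  (x > 0).\<close>
definition besselK :: "real \<Rightarrow> real \<Rightarrow> real" where
  "besselK \<nu> x = integral {0..} (\<lambda>t. exp (- x * cosh t) * cosh (\<nu> * t))"

definition vg_density :: "real \<Rightarrow> real \<Rightarrow> real \<Rightarrow> real \<Rightarrow> real" where
  "vg_density \<mu> \<alpha> \<beta> x =
     (\<alpha>\<^sup>2 - \<beta>\<^sup>2) powr (\<mu> + 1/2) / (sqrt pi * (2 * \<alpha>) powr \<mu> * Gamma (\<mu> + 1/2))
     * exp (\<beta> * x) * \<bar>x\<bar> powr \<mu> * besselK \<mu> (\<alpha> * \<bar>x\<bar>)"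

text \<open>Meijer G-function G^{4,0}_{0,4}(x | -; b1,b2,b3,b4) for x > 0, with the
  contour L taken as the vertical line Re s = c, c = min b_j - 1, which lies to the
  left of all poles of the Gamma(b_j - s):
  (1/(2 pi i)) int_{c - i infty}^{c + i infty} ... ds = (1/(2 pi)) int_R ... (c + i t) dt.\<close>
definition meijerG_40_04 :: "real \<Rightarrow> real \<Rightarrow> real \<Rightarrow> real \<Rightarrow> real \<Rightarrow> real" where
  "meijerG_40_04 x b1 b2 b3 b4 =
     (let c = min (min b1 b2) (min b3 b4) - 1 in
      Re (integral UNIV (\<lambda>t::real. let s = Complex c t in
          Gamma (complex_of_real b1 - s) * Gamma (complex_of_real b2 - s) *
          Gamma (complex_of_real b3 - s) * Gamma (complex_of_real b4 - s) *
          complex_of_real x powr s)) / (2 * pi))"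

definition vg_prod_term ::
  "real \<Rightarrow> real \<Rightarrow> real \<Rightarrow> real \<Rightarrow> real \<Rightarrow> real \<Rightarrow> real \<Rightarrow> nat \<Rightarrow> real" where
  "vg_prod_term m n \<alpha>1 \<beta>1 \<alpha>2 \<beta>2 z i =
     (\<Sum>j = 0..2*i. (sgn z) ^ j / (fact j * fact (2*i - j))
        * (2 * \<beta>1 / \<alpha>1) ^ j * (2 * \<beta>2 / \<alpha>2) ^ (2*i - j)
        * meijerG_40_04 (\<alpha>1\<^sup>2 * \<alpha>2\<^sup>2 / 16 * z\<^sup>2)
            (real j / 2) (real i - real j / 2) (m + real j / 2) (n + real i - real j / 2))"

definition vg_prod_const :: "real \<Rightarrow> real \<Rightarrow> real \<Rightarrow> real \<Rightarrow> real \<Rightarrow> real \<Rightarrow> real" where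
  "vg_prod_const m n \<alpha>1 \<beta>1 \<alpha>2 \<beta>2 =
     sqrt (\<alpha>1\<^sup>2 - \<beta>1\<^sup>2) powr (2*m + 1) * sqrt (\<alpha>2\<^sup>2 - \<beta>2\<^sup>2) powr (2*n + 1)
     / (4 * pi * \<alpha>1 powr (2*m) * \<alpha>2 powr (2*n) * Gamma (m + 1/2) * Gamma (n + 1/2))"

end

theory Submission
  imports Defs
begin

text \<open>
  In the logarithmic variable put E_b(u) = exp(b u - exp u). Its Fourier transform is
  t \<mapsto> Gamma(b - i t), so the Mellin--Barnes integral defining G at exp v is, by Fourier inversion,
  the four-fold additive convolution of such kernels evaluated at v (the factor exp(c v) undoes
  the shift of the parameters by the abscissa c). A convolution of two of them is a Bessel function:
  (E_a * E_b)(2 r) = 2 exp((a + b) r) K_{a-b}(2 exp r). Grouping the four factors in pairs, G is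
  therefore an explicit integral of a product of two Bessel functions.

  On the other side f_Z(z) = int f_X(x) f_Y(z/x) dx/|x|. Folding x < 0 onto x > 0 turns the factor
  exp(\<beta>1 x + \<beta>2 z/x) into 2 cosh(\<beta>1 x + \<beta>2 z/x), whose power series has only nonnegative terms,
  so it can be integrated term by term; the binomial theorem then produces the double sum.
  Convergence at every z \<noteq> 0 follows from finiteness of f_Z almost everywhere, because
  exp(\<beta> y) K(\<alpha> |y|) is decreasing along rays.
\<close>

section \<open>Fourier inversion on the line\<close>

text \<open>Unnormalised, so inversion carries a factor 2 pi. With the minus sign the transform of
  \<open>gexp b\<close> at \<open>t\<close> is Gamma(b - i t), which matches the factors Gamma(b -
  s) on a vertical contour.\<close>

definition fourier :: "(real \<Rightarrow> real) \<Rightarrow> real \<Rightarrow> complex" where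
  "fourier g t = (LINT u|lborel. g u *\<^sub>R cis (- (t * u)))"

definition conv :: "(real \<Rightarrow> real) \<Rightarrow> (real \<Rightarrow> real) \<Rightarrow> real \<Rightarrow> real" where
  "conv g h v = (LINT u|lborel. g u * h (v - u))"

text \<open>A class closed under convolution on which inversion holds at every point: boundedness
  makes each convolution integral converge everywhere, and continuity gives pointwise
  values.\<close>

definition tame :: "(real \<Rightarrow> real) \<Rightarrow> bool" where
  "tame g \<longleftrightarrow> integrable lborel g \<and> continuous_on UNIV g \<and> (\<exists>B. \<forall>u. \<bar>g u\<bar> \<le> B)"

lemma cis_measurable [measurable]: "cis \<in> borel_measurable borel"
  by (intro borel_measurable_continuous_onI continuous_intros)

lemma tameD:
  assumes "tame g"
  shows "integrable lborel g" "continuous_on UNIV g" "g \<in> borel_measurable borel"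
  using assms by (auto simp: tame_def dest: borel_measurable_integrable)

lemma tame_bound:
  assumes "tame g" obtains B where "\<And>u. \<bar>g u\<bar> \<le> B"
  using assms by (auto simp: tame_def)

section \<open>Convolutions and their transforms\<close>

lemma integrable_scaleR_bounded:
  fixes h :: "real \<Rightarrow> 'a::{banach, second_countable_topology}"
  assumes "integrable lborel g" "h \<in> borel_measurable borel" "\<And>u. norm (h u) \<le> B"
  shows "integrable lborel (\<lambda>u. g u *\<^sub>R h u)"
proof (rule Bochner_Integration.integrable_bound)
  show "integrable lborel (\<lambda>u. B * g u)" using assms(1) by simp
  show "(\<lambda>u. g u *\<^sub>R h u) \<in> borel_measurable lborel"
    using assms(1,2) by (auto dest: borel_measurable_integrable)
  have "0 \<le> B" using assms(3)[of undefined] norm_ge_zero order_trans by blast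
  then show "AE x in lborel. norm (g x *\<^sub>R h x) \<le> norm (B * g x)"
    using assms(3) by (intro AE_I2) (auto simp: abs_mult mult.commute[of B] intro!: mult_left_mono)
qed

lemma integrable_shift:
  fixes h :: "real \<Rightarrow> real"
  assumes "integrable lborel h"
  shows "integrable lborel (\<lambda>v. h (v - u))"
  using lborel_integrable_real_affine[OF assms, of 1 "-u"] by simp

lemma integral_shift:
  fixes h :: "real \<Rightarrow> 'a::{banach, second_countable_topology}"
  shows "(LINT v|lborel. h (v - u)) = (LINT v|lborel. h v)"
  using lborel_integral_real_affine[of 1 h "-u"] by (simp add: algebra_simps)

text \<open>The Fubini hypothesis for convolutions. By translation invariance the inner integral of
  the modulus is at most \<open>\<bar>g u\<bar>\<close> times the L1 norm of \<open>h\<close>. The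
  weight \<open>k\<close> is 1 for integrability of \<open>conv g h\<close> and a character for its
  transform.\<close>

lemma conv_pair_integrable:
  fixes k :: "real \<Rightarrow> complex"
  assumes g: "tame g" and h: "tame h"
    and k [measurable]: "k \<in> borel_measurable borel" and k1: "\<And>v. norm (k v) \<le> 1"
  shows "integrable (lborel \<Otimes>\<^sub>M lborel) (\<lambda>(u, v). (g u * h (v - u)) *\<^sub>R k v)"
proof -
  note [measurable] = tameD(3)[OF g] tameD(3)[OF h]
  have ih: "integrable lborel (\<lambda>v. g u * h (v - u))" for u
    using integrable_shift[OF tameD(1)[OF h]] by simp
  have i2: "integrable lborel (\<lambda>v. (g u * h (v - u)) *\<^sub>R k v)" for u
    by (rule integrable_scaleR_bounded[where B=1]) (use k1 ih in auto)
  have eq: "(LINT v|lborel. norm ((g u * h (v - u)) *\<^sub>R k v)) \<le> \<bar>g u\<bar> * (LINT v|lborel. \<bar>h v\<bar>)" for u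
  proof -
    have "(LINT v|lborel. norm ((g u * h (v - u)) *\<^sub>R k v)) \<le> (LINT v|lborel. \<bar>g u * h (v - u)\<bar>)"
      using k1 by (intro integral_mono integrable_norm i2 integrable_abs ih) (auto simp: mult_left_le)
    also have "\<dots> = \<bar>g u\<bar> * (LINT v|lborel. \<bar>h (v - u)\<bar>)" by (simp add: abs_mult)
    also have "(LINT v|lborel. \<bar>h (v - u)\<bar>) = (LINT v|lborel. \<bar>h v\<bar>)" by (rule integral_shift)
    finally show ?thesis .
  qed
  have "integrable (lborel \<Otimes>\<^sub>M lborel) (\<lambda>p. (g (fst p) * h (snd p - fst p)) *\<^sub>R k (snd p))"
  proof (rule lborel_pair.Fubini_integrable)
    show "integrable lborel (\<lambda>x. LINT y|lborel. norm ((g (fst (x, y)) * h (snd (x, y) - fst (x, y))) *\<^sub>R k (snd (x, y))))"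
    proof (rule Bochner_Integration.integrable_bound)
      show "integrable lborel (\<lambda>u. \<bar>g u\<bar> * (LINT v|lborel. \<bar>h v\<bar>))"
        using tameD(1)[OF g] by simp
      show "AE x in lborel. norm (LINT y|lborel. norm ((g (fst (x, y)) * h (snd (x, y) - fst (x, y))) *\<^sub>R k (snd (x, y)))) \<le> norm (\<bar>g x\<bar> * (LINT v|lborel. \<bar>h v\<bar>))"
      proof (intro AE_I2)
        fix u
        have "norm (LINT v|lborel. norm ((g u * h (v - u)) *\<^sub>R k v)) = (LINT v|lborel. norm ((g u * h (v - u)) *\<^sub>R k v))"
          by (subst real_norm_def, subst abs_of_nonneg) auto
        also have "\<dots> \<le> \<bar>g u\<bar> * (LINT v|lborel. \<bar>h v\<bar>)" by (rule eq)
        also have "\<dots> \<le> norm (\<bar>g u\<bar> * (LINT v|lborel. \<bar>h v\<bar>))" by simp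
        finally show "norm (LINT y|lborel. norm ((g (fst (u, y)) * h (snd (u, y) - fst (u, y))) *\<^sub>R k (snd (u, y)))) \<le> norm (\<bar>g u\<bar> * (LINT v|lborel. \<bar>h v\<bar>))" by simp
      qed
    qed measurable
  qed (use i2 in auto)
  then show ?thesis by (simp add: case_prod_unfold)
qed

text \<open>Integrability is Fubini; continuity and boundedness both come from the majorant
  \<open>B * \<bar>g u\<bar>\<close>, where \<open>B\<close> bounds \<open>h\<close>.\<close>

lemma tame_conv:
  assumes g: "tame g" and h: "tame h"
  shows "tame (conv g h)"
proof -
  note [measurable] = tameD(3)[OF g] tameD(3)[OF h]
  obtain B where B: "\<And>u. \<bar>h u\<bar> \<le> B" using tame_bound[OF h] by blast
  have i: "integrable lborel (\<lambda>u. g u * h (v - u))" for v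
    using integrable_scaleR_bounded[OF tameD(1)[OF g], of "\<lambda>u. h (v - u)" B] B by simp
  \<comment> \<open>The trivial character is complex-valued here, so the real part has to be taken
    to get back to \<open>conv g h\<close>.\<close>
  have "integrable (lborel \<Otimes>\<^sub>M lborel) (\<lambda>(u, v). (g u * h (v - u)) *\<^sub>R (1::complex))"
    by (rule conv_pair_integrable[OF g h]) auto
  then have "integrable lborel (\<lambda>v. LINT u|lborel. (g u * h (v - u)) *\<^sub>R (1::complex))"
    by (rule lborel_pair.integrable_snd)
  then have "integrable lborel (\<lambda>v. Re (LINT u|lborel. (g u * h (v - u)) *\<^sub>R (1::complex)))"
    by (rule integrable_Re)
  moreover have "Re (LINT u|lborel. (g u * h (v - u)) *\<^sub>R (1::complex)) = conv g h v" for v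
    using i[of v] by (simp add: conv_def scaleR_conv_of_real flip: of_real_mult)
  ultimately have "integrable lborel (conv g h)" by simp
  moreover have "continuous_on UNIV (conv g h)"
  proof (rule continuous_on_sequentiallyI)
    fix x :: "nat \<Rightarrow> real" and a assume x: "x \<longlonglongrightarrow> a"
    show "(\<lambda>n. conv g h (x n)) \<longlonglongrightarrow> conv g h a"
      unfolding conv_def
    proof (rule integral_dominated_convergence[where w="\<lambda>u. B * \<bar>g u\<bar>"])
      show "integrable lborel (\<lambda>u. B * \<bar>g u\<bar>)" using tameD(1)[OF g] by simp
      show "AE u in lborel. (\<lambda>n. g u * h (x n - u)) \<longlonglongrightarrow> g u * h (a - u)"
      proof (intro AE_I2 tendsto_intros)
        fix u
        have "isCont h (a - u)" using tameD(2)[OF h] by (simp add: continuous_on_eq_continuous_at)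
        then show "(\<lambda>n. h (x n - u)) \<longlonglongrightarrow> h (a - u)"
          by (rule isCont_tendsto_compose) (intro tendsto_intros x)
      qed
      show "AE u in lborel. norm (g u * h (x n - u)) \<le> B * \<bar>g u\<bar>" for n
        using B by (intro AE_I2) (auto simp: abs_mult mult.commute[of B] intro!: mult_left_mono)
    qed auto
  qed
  moreover have "\<bar>conv g h v\<bar> \<le> (LINT u|lborel. B * \<bar>g u\<bar>)" for v
  proof -
    have "\<bar>conv g h v\<bar> \<le> (LINT u|lborel. \<bar>g u * h (v - u)\<bar>)"
      unfolding conv_def by (rule integral_abs_bound)
    also have "\<dots> \<le> (LINT u|lborel. B * \<bar>g u\<bar>)"
      using tameD(1)[OF g] B
      by (intro integral_mono integrable_abs i) (auto simp: abs_mult mult.commute[of B] intro!: mult_left_mono)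
    finally show ?thesis .
  qed
  ultimately show ?thesis unfolding tame_def by blast
qed

text \<open>The character splits as \<open>cis (- (t * u)) * cis (- (t * (v - u)))\<close>; after
  exchanging the integrals, the inner one is a translate of the integral defining
  \<open>fourier h t\<close>.\<close>

lemma fourier_conv:
  assumes g: "tame g" and h: "tame h"
  shows "fourier (conv g h) t = fourier g t * fourier h t"
proof -
  note [measurable] = tameD(3)[OF g] tameD(3)[OF h]
  obtain B where B: "\<And>u. \<bar>h u\<bar> \<le> B" using tame_bound[OF h] by blast
  have i: "integrable lborel (\<lambda>u. g u * h (v - u))" for v
    using integrable_scaleR_bounded[OF tameD(1)[OF g], of "\<lambda>u. h (v - u)" B] B by simp
  have I: "integrable (lborel \<Otimes>\<^sub>M lborel) (\<lambda>(u, v). (g u * h (v - u)) *\<^sub>R cis (- (t * v)))"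
    by (rule conv_pair_integrable[OF g h]) auto
  have "fourier (conv g h) t = (LINT v|lborel. LINT u|lborel. (g u * h (v - u)) *\<^sub>R cis (- (t * v)))"
    unfolding fourier_def conv_def using i by (intro Bochner_Integration.integral_cong) auto
  also have "\<dots> = (LINT u|lborel. LINT v|lborel. (g u * h (v - u)) *\<^sub>R cis (- (t * v)))"
    by (rule lborel_pair.Fubini_integral[OF I])
  also have "\<dots> = (LINT u|lborel. (g u *\<^sub>R cis (- (t * u))) * fourier h t)"
  proof (intro Bochner_Integration.integral_cong refl)
    fix u
    have "(LINT v|lborel. (g u * h (v - u)) *\<^sub>R cis (- (t * v)))
        = (LINT v|lborel. (g u *\<^sub>R cis (- (t * u))) * (h (v - u) *\<^sub>R cis (- (t * (v - u)))))"
      by (intro Bochner_Integration.integral_cong refl)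
         (simp add: scaleR_conv_of_real cis_mult algebra_simps)
    also have "\<dots> = (g u *\<^sub>R cis (- (t * u))) * (LINT v|lborel. h (v - u) *\<^sub>R cis (- (t * (v - u))))"
      by (rule integral_mult_right_zero)
    also have "(LINT v|lborel. h (v - u) *\<^sub>R cis (- (t * (v - u)))) = fourier h t"
      unfolding fourier_def by (rule integral_shift)
    finally show "(LINT v|lborel. (g u * h (v - u)) *\<^sub>R cis (- (t * v))) = (g u *\<^sub>R cis (- (t * u))) * fourier h t" .
  qed
  also have "\<dots> = fourier g t * fourier h t"
    unfolding fourier_def by (rule integral_mult_left_zero)
  finally show ?thesis .
qed

section \<open>Gaussian damping and inversion\<close>

lemma gaussian_fourier:
  "(LINT x|lborel. std_normal_density x *\<^sub>R cis (s * x)) = of_real (exp (- s\<^sup>2 / 2))"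
proof -
  have "char std_normal_distribution s = (LINT x|lborel. std_normal_density x *\<^sub>R iexp (s * x))"
    unfolding char_def by (rule integral_density) (auto simp: normal_density_nonneg)
  then show ?thesis by (simp add: char_std_normal_distribution cis_conv_exp)
qed

lemma gaussian_fourier_scaled:
  assumes "e > 0"
  shows "(LINT t|lborel. std_normal_density (e * t) *\<^sub>R cis (t * s)) = of_real (exp (- (s / e)\<^sup>2 / 2) / e)"
proof -
  have "(LINT t|lborel. std_normal_density (e * t) *\<^sub>R cis (t * s))
      = (1 / e) *\<^sub>R (LINT x|lborel. std_normal_density (e * (0 + (1 / e) * x)) *\<^sub>R cis ((0 + (1 / e) * x) * s))"
    using assms by (subst lborel_integral_real_affine[of "1 / e" _ 0]) auto
  also have "(LINT x|lborel. std_normal_density (e * (0 + (1 / e) * x)) *\<^sub>R cis ((0 + (1 / e) * x) * s))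
      = (LINT x|lborel. std_normal_density x *\<^sub>R cis (s / e * x))"
    using assms by (intro Bochner_Integration.integral_cong) (auto simp: field_simps)
  also have "\<dots> = of_real (exp (- (s / e)\<^sup>2 / 2))" by (rule gaussian_fourier)
  finally show ?thesis by (simp add: scaleR_conv_of_real)
qed

text \<open>The Fourier integral is damped by \<open>\<phi> (e * t)\<close>, which turns it into a Gaussian average of \<open>g\<close> around \<open>v\<close>; then \<open>e\<close> tends to 0.\<close>

lemma fourier_inversion:
  assumes g: "tame g" and F: "integrable lborel (fourier g)"
  shows "(LINT t|lborel. fourier g t * cis (t * v)) = of_real (2 * pi * g v)"
proof -
  note [measurable] = tameD(3)[OF g] borel_measurable_integrable[OF F]
  obtain B where B: "\<And>u. \<bar>g u\<bar> \<le> B" using tame_bound[OF g] by blast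
  define \<phi> where "\<phi> = std_normal_density"
  have [measurable]: "\<phi> \<in> borel_measurable borel" unfolding \<phi>_def by simp
  have \<phi>0: "\<phi> 0 = 1 / sqrt (2 * pi)" by (simp add: \<phi>_def std_normal_density_def)
  have \<phi>cont: "isCont \<phi> x" for x
    unfolding \<phi>_def std_normal_density_def by (intro continuous_intros) auto
  have \<phi>pos: "0 \<le> \<phi> x" "\<phi> x \<le> \<phi> 0" for x by (auto simp: \<phi>_def std_normal_density_def divide_le_cancel)
  have i\<phi>: "integrable lborel \<phi>" unfolding \<phi>_def by simp
  have ie: "integrable lborel (\<lambda>t. \<phi> (e * t))" if "e > 0" for e
    using lborel_integrable_real_affine[OF i\<phi>, of e 0] that by simp
  have key: "(LINT t|lborel. (fourier g t * cis (t * v)) * \<phi> (e * t)) = of_real (sqrt (2 * pi) * (LINT x|lborel. g (v + e * x) * \<phi> x))"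
    if e: "e > 0" for e
  proof -
    \<comment> \<open>The damping is what allows Fubini: without \<open>\<phi> (e * t)\<close> the
      integrand has modulus \<open>\<bar>g u\<bar>\<close>, constant in \<open>t\<close>.\<close>
    have I: "integrable (lborel \<Otimes>\<^sub>M lborel) (\<lambda>(u, t). g u *\<^sub>R cis (- (t * u)) * cis (t * v) * \<phi> (e * t))"
    proof -
      have "integrable (lborel \<Otimes>\<^sub>M lborel) (\<lambda>p. g (fst p) *\<^sub>R cis (- (snd p * fst p)) * cis (snd p * v) * \<phi> (e * snd p))"
      proof (rule lborel_pair.Fubini_integrable)
        show "integrable lborel (\<lambda>x. LINT y|lborel. norm (g (fst (x, y)) *\<^sub>R cis (- (snd (x, y) * fst (x, y))) * cis (snd (x, y) * v) * \<phi> (e * snd (x, y))))"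
          using tameD(1)[OF g] by (simp add: norm_mult)
        show "AE u in lborel. integrable lborel (\<lambda>y. g (fst (u, y)) *\<^sub>R cis (- (snd (u, y) * fst (u, y))) * cis (snd (u, y) * v) * \<phi> (e * snd (u, y)))"
        proof (intro AE_I2)
          fix u
          have "integrable lborel (\<lambda>y. \<phi> (e * y) *\<^sub>R (g u *\<^sub>R cis (- (y * u)) * cis (y * v)))"
            by (rule integrable_scaleR_bounded[OF ie[OF e], where B="\<bar>g u\<bar>"]) (auto simp: norm_mult)
          then show "integrable lborel (\<lambda>y. g (fst (u, y)) *\<^sub>R cis (- (snd (u, y) * fst (u, y))) * cis (snd (u, y) * v) * \<phi> (e * snd (u, y)))"
            by (simp add: scaleR_conv_of_real mult.commute mult.left_commute)
        qed
      qed measurable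
      then show ?thesis by (simp add: case_prod_unfold)
    qed
    have "(LINT t|lborel. (fourier g t * cis (t * v)) * \<phi> (e * t))
        = (LINT t|lborel. LINT u|lborel. g u *\<^sub>R cis (- (t * u)) * cis (t * v) * \<phi> (e * t))"
      by (simp only: fourier_def integral_mult_left_zero[symmetric])
    also have "\<dots> = (LINT u|lborel. LINT t|lborel. g u *\<^sub>R cis (- (t * u)) * cis (t * v) * \<phi> (e * t))"
      by (rule lborel_pair.Fubini_integral[OF I])
    also have "\<dots> = (LINT u|lborel. of_real (g u * (exp (- ((v - u) / e)\<^sup>2 / 2) / e)))"
    proof (intro Bochner_Integration.integral_cong refl)
      fix u
      have "(LINT t|lborel. g u *\<^sub>R cis (- (t * u)) * cis (t * v) * \<phi> (e * t))
          = (LINT t|lborel. of_real (g u) * (\<phi> (e * t) *\<^sub>R cis (t * (v - u))))"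
        by (intro Bochner_Integration.integral_cong refl)
           (simp add: scaleR_conv_of_real cis_mult algebra_simps)
      also have "\<dots> = of_real (g u) * of_real (exp (- ((v - u) / e)\<^sup>2 / 2) / e)"
        using gaussian_fourier_scaled[OF e, of "v - u"] unfolding \<phi>_def by (simp only: integral_mult_right_zero)
      finally show "(LINT t|lborel. g u *\<^sub>R cis (- (t * u)) * cis (t * v) * \<phi> (e * t)) = of_real (g u * (exp (- ((v - u) / e)\<^sup>2 / 2) / e))" by simp
    qed
    also have "\<dots> = of_real (LINT u|lborel. g u * (exp (- ((v - u) / e)\<^sup>2 / 2) / e))"
      by (rule integral_complex_of_real)
    finally have 1: "(LINT t|lborel. (fourier g t * cis (t * v)) * \<phi> (e * t))
        = of_real (LINT u|lborel. g u * (exp (- ((v - u) / e)\<^sup>2 / 2) / e))" .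
    \<comment> \<open>Substituting u = v + e x makes the Gaussian weight independent of
      \<open>e\<close>; it equals \<open>sqrt (2 * pi) * \<phi> x\<close>.\<close>
    have 2: "(LINT u|lborel. g u * (exp (- ((v - u) / e)\<^sup>2 / 2) / e))
      = sqrt (2 * pi) * (LINT x|lborel. g (v + e * x) * \<phi> x)"
    proof -
      have "(LINT u|lborel. g u * (exp (- ((v - u) / e)\<^sup>2 / 2) / e))
          = e *\<^sub>R (LINT x|lborel. g (v + e * x) * (exp (- ((v - (v + e * x)) / e)\<^sup>2 / 2) / e))"
        using e by (subst lborel_integral_real_affine[of e _ v]) auto
      also have "\<dots> = (LINT x|lborel. e * (g (v + e * x) * (exp (- ((v - (v + e * x)) / e)\<^sup>2 / 2) / e)))"
        by (simp only: real_scaleR_def integral_mult_right_zero)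
      also have "\<dots> = (LINT x|lborel. sqrt (2 * pi) * (g (v + e * x) * \<phi> x))"
        using e by (intro Bochner_Integration.integral_cong) (auto simp: \<phi>_def std_normal_density_def)
      finally show ?thesis by (simp only: integral_mult_right_zero)
    qed
    show ?thesis unfolding 1 2 ..
  qed
  define e where "e n = 1 / real (Suc n)" for n
  have e0: "e \<longlonglongrightarrow> 0" unfolding e_def by (rule LIMSEQ_Suc[OF lim_1_over_n])
  have epos: "e n > 0" for n by (simp add: e_def)
  \<comment> \<open>On the frequency side \<open>\<phi>\<close> is largest at 0 and
    \<open>fourier g\<close> is integrable; on the other side, below, \<open>g\<close> is bounded
    and \<open>\<phi>\<close> is integrable.\<close>
  have L: "(\<lambda>n. LINT t|lborel. (fourier g t * cis (t * v)) * \<phi> (e n * t)) \<longlonglongrightarrow> (LINT t|lborel. (fourier g t * cis (t * v)) * \<phi> 0)"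
  proof (rule integral_dominated_convergence[where w="\<lambda>t. norm (fourier g t) * \<phi> 0"])
    show "integrable lborel (\<lambda>t. norm (fourier g t) * \<phi> 0)" using F by simp
    show "AE t in lborel. (\<lambda>n. (fourier g t * cis (t * v)) * \<phi> (e n * t)) \<longlonglongrightarrow> (fourier g t * cis (t * v)) * \<phi> 0"
    proof (intro AE_I2 tendsto_intros)
      fix t
      have "(\<lambda>n. e n * t) \<longlonglongrightarrow> 0 * t" by (intro tendsto_intros e0)
      then show "(\<lambda>n. \<phi> (e n * t)) \<longlonglongrightarrow> \<phi> 0" using isCont_tendsto_compose[OF \<phi>cont] by simp
    qed
    show "AE t in lborel. norm ((fourier g t * cis (t * v)) * \<phi> (e n * t)) \<le> norm (fourier g t) * \<phi> 0" for n
      using \<phi>pos by (intro AE_I2) (auto simp: norm_mult intro!: mult_left_mono)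
  qed auto
  have R: "(\<lambda>n. LINT x|lborel. g (v + e n * x) * \<phi> x) \<longlonglongrightarrow> (LINT x|lborel. g v * \<phi> x)"
  proof (rule integral_dominated_convergence[where w="\<lambda>x. B * \<phi> x"])
    show "integrable lborel (\<lambda>x. B * \<phi> x)" using i\<phi> by simp
    show "AE x in lborel. (\<lambda>n. g (v + e n * x) * \<phi> x) \<longlonglongrightarrow> g v * \<phi> x"
    proof (intro AE_I2 tendsto_intros)
      fix x
      have "(\<lambda>n. v + e n * x) \<longlonglongrightarrow> v + 0 * x" by (intro tendsto_intros e0)
      moreover have "isCont g v" using tameD(2)[OF g] by (simp add: continuous_on_eq_continuous_at)
      ultimately show "(\<lambda>n. g (v + e n * x)) \<longlonglongrightarrow> g v" using isCont_tendsto_compose by simp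
    qed
    show "AE x in lborel. norm (g (v + e n * x) * \<phi> x) \<le> B * \<phi> x" for n
      using B \<phi>pos by (intro AE_I2) (auto simp: abs_mult intro!: mult_right_mono)
  qed auto
  have "(\<lambda>n. complex_of_real (sqrt (2 * pi) * (LINT x|lborel. g (v + e n * x) * \<phi> x)))
      \<longlonglongrightarrow> of_real (sqrt (2 * pi) * (LINT x|lborel. g v * \<phi> x))"
    by (intro tendsto_intros R)
  \<comment> \<open>Since \<open>\<phi> 0 = 1 / sqrt (2 * pi)\<close>, clearing it yields a second
    factor \<open>sqrt (2 * pi)\<close> and hence the constant 2 pi.\<close>
  from LIMSEQ_unique[OF L[unfolded key[OF epos]] this]
  have "(LINT t|lborel. fourier g t * cis (t * v)) * \<phi> 0 = of_real (sqrt (2 * pi) * (g v * (LINT x|lborel. \<phi> x)))"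
    by simp
  moreover have "(LINT x|lborel. \<phi> x) = 1" unfolding \<phi>_def by simp
  ultimately have "(LINT t|lborel. fourier g t * cis (t * v)) / sqrt (2 * pi) = of_real (sqrt (2 * pi) * g v)"
    unfolding \<phi>0 by simp
  then have "(LINT t|lborel. fourier g t * cis (t * v)) = of_real (sqrt (2 * pi) * g v) * of_real (sqrt (2 * pi))"
    by (simp add: divide_eq_eq del: of_real_mult)
  also have "\<dots> = of_real (2 * pi * g v)"
    by (simp flip: of_real_mult add: mult.commute mult.left_commute)
  finally show ?thesis .
qed

section \<open>Gamma and Bessel functions as convolutions of Gumbel-type kernels\<close>

text \<open>Bridge between Euler's integral and the change of variables, phrased with
  \<open>integral\<close> and \<open>absolutely_integrable_on\<close>, and Fubini over
  \<open>lborel\<close>.\<close>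

lemma absolutely_integrable_UNIV_lborel:
  fixes f :: "real \<Rightarrow> 'a::euclidean_space"
  assumes "f absolutely_integrable_on UNIV" "f \<in> borel_measurable borel"
  shows "integrable lborel f" "(LINT x|lborel. f x) = integral UNIV f"
proof -
  have "integrable lebesgue f" using assms(1) by (simp add: set_integrable_def)
  then show i: "integrable lborel f" using integrable_completion[of f lborel] assms(2) by simp
  show "(LINT x|lborel. f x) = integral UNIV f"
    using set_borel_integral_eq_integral(2)[of UNIV f] i by (simp add: set_integrable_def set_lebesgue_integral_def)
qed

text \<open>Euler's integrand x^b exp(-x) with respect to dx/x, written in the variable x = exp
  u.\<close>

definition gexp :: "real \<Rightarrow> real \<Rightarrow> real" where
  "gexp b u = exp (b * u - exp u)"

lemma gexp_continuous: "continuous_on UNIV (gexp b)"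
  unfolding gexp_def by (intro continuous_intros)

lemma gexp_measurable [measurable]: "gexp b \<in> borel_measurable borel"
  by (rule borel_measurable_continuous_onI[OF gexp_continuous])

text \<open>Euler's integral for Gamma(b - i t) under x = exp u: the Jacobian \<open>exp u\<close>
  raises the exponent z - 1 to z.\<close>

lemma gexp_fourier_aux:
  assumes b: "b > 0"
  shows "(\<lambda>u. gexp b u *\<^sub>R cis (- (t * u))) absolutely_integrable_on UNIV"
    and "integral UNIV (\<lambda>u. gexp b u *\<^sub>R cis (- (t * u))) = Gamma (Complex b (- t))"
proof -
  define z where "z = Complex b (- t)"
  define f where "f = (\<lambda>x. complex_of_real x powr (z - 1) / of_real (exp x))"
  have z: "Re z > 0" using b by (simp add: z_def)
  have range: "range exp = {0::real<..}"
    by (auto simp: image_iff) (metis exp_ln)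
  have eq: "\<bar>exp u\<bar> *\<^sub>R f (exp u) = gexp b u *\<^sub>R cis (- (t * u))" for u :: real
  proof -
    have "\<bar>exp u\<bar> *\<^sub>R f (exp u) = exp (of_real u) * exp ((z - 1) * of_real u) / exp (of_real (exp u))"
      by (simp add: f_def powr_def Ln_of_real scaleR_conv_of_real flip: exp_of_real)
    also have "\<dots> = exp (of_real u + (z - 1) * of_real u - of_real (exp u))"
      by (simp add: exp_add exp_diff)
    also have "of_real u + (z - 1) * of_real u - of_real (exp u) = of_real (b * u - exp u) + \<i> * of_real (- (t * u))"
      by (simp add: z_def complex_eq_iff algebra_simps)
    also have "exp \<dots> = gexp b u *\<^sub>R cis (- (t * u))"
      by (simp only: exp_add exp_of_real cis_conv_exp gexp_def scaleR_conv_of_real)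
    finally show ?thesis .
  qed
  have "f absolutely_integrable_on {0<..} \<and> integral {0<..} f = Gamma z"
    using absolutely_integrable_Gamma_integral'[OF z] Gamma_integral_complex'[OF z]
    by (auto simp: f_def integral_unique)
  then have "(\<lambda>u. \<bar>exp u\<bar> *\<^sub>R f (exp u)) absolutely_integrable_on UNIV \<and>
      integral UNIV (\<lambda>u. \<bar>exp u\<bar> *\<^sub>R f (exp u)) = Gamma z"
    unfolding range[symmetric]
    by (subst has_absolute_integral_change_of_variables_real)
       (auto intro!: derivative_eq_intros simp: inj_on_def)
  then show "(\<lambda>u. gexp b u *\<^sub>R cis (- (t * u))) absolutely_integrable_on UNIV"
    "integral UNIV (\<lambda>u. gexp b u *\<^sub>R cis (- (t * u))) = Gamma (Complex b (- t))"
    unfolding eq z_def by auto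
qed

lemma fourier_gexp:
  assumes "b > 0"
  shows "fourier (gexp b) t = Gamma (Complex b (- t))"
proof -
  have "(\<lambda>u. gexp b u *\<^sub>R cis (- (t * u))) \<in> borel_measurable borel" by measurable
  then show ?thesis
    unfolding fourier_def
    using absolutely_integrable_UNIV_lborel(2)[OF gexp_fourier_aux(1)[OF assms, of t]] gexp_fourier_aux(2)[OF assms, of t]
    by simp
qed

lemma tame_gexp:
  assumes b: "b > 0"
  shows "tame (gexp b)"
proof -
  have "(\<lambda>u. gexp b u *\<^sub>R cis (- (0 * u))) \<in> borel_measurable borel" by measurable
  from absolutely_integrable_UNIV_lborel(1)[OF gexp_fourier_aux(1)[OF b] this]
  have "integrable lborel (\<lambda>u. Re (gexp b u *\<^sub>R cis (- (0 * u))))" by (rule integrable_Re)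
  then have "integrable lborel (gexp b)" by simp
  moreover have "\<bar>gexp b u\<bar> \<le> exp (b * ln b)" for u
  proof -
    \<comment> \<open>\<open>b * u - exp u\<close> peaks at \<open>u = ln b\<close>; the inequality
      is the tangent line of exp there.\<close>
    have "b * (1 + (u - ln b)) \<le> b * exp (u - ln b)"
      using b by (intro mult_left_mono exp_ge_add_one_self) auto
    also have "\<dots> = exp u" using b by (simp add: exp_diff)
    finally show ?thesis using b by (simp add: gexp_def algebra_simps)
  qed
  ultimately show ?thesis using gexp_continuous by (auto simp: tame_def)
qed

section \<open>Decay of Gamma on vertical lines and the Mellin-Barnes integral\<close>

lemma norm_Gamma_le:
  assumes a: "a \<ge> 1"
  shows "norm (Gamma (Complex a t)) \<le> (LINT u|lborel. gexp (a + 2) u) / (1 + t\<^sup>2)"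
proof -
  define z where "z = Complex a t"
  have nz: "Re z > 0" using a by (simp add: z_def)
  have "z \<notin> \<int>\<^sub>\<le>\<^sub>0" "z + 1 \<notin> \<int>\<^sub>\<le>\<^sub>0"
    using nz by (auto elim!: nonpos_Ints_cases simp: complex_eq_iff)
  \<comment> \<open>two steps of the functional equation trade the bounded factor \<open>Gamma (z + 2)\<close> for quadratic decay\<close>
  then have "Gamma (z + 1 + 1) = (z + 1) * (z * Gamma z)"
    by (metis Gamma_plus1)
  moreover have z2: "z + 1 + 1 = Complex (a + 2) t" by (simp add: z_def complex_eq_iff)
  ultimately have 1: "norm (Gamma (Complex (a + 2) t)) = norm (z + 1) * (norm z * norm (Gamma z))"
    by (simp only: norm_mult)
  \<comment> \<open>The real parts of \<open>z\<close> and \<open>z + 1\<close> are at least 1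
    because \<open>a \<ge> 1\<close>.\<close>
  have le: "sqrt (1 + t\<^sup>2) \<le> norm z" "sqrt (1 + t\<^sup>2) \<le> norm (z + 1)"
    using a by (auto simp: z_def cmod_def intro!: power_mono)
  have "sqrt (1 + t\<^sup>2) * (sqrt (1 + t\<^sup>2) * norm (Gamma z)) \<le> norm (z + 1) * (norm z * norm (Gamma z))"
    by (intro mult_mono le mult_nonneg_nonneg) auto
  also have "\<dots> = norm (fourier (gexp (a + 2)) (- t))"
    using a by (simp add: fourier_gexp 1)
  also have "\<dots> \<le> (LINT u|lborel. norm (gexp (a + 2) u *\<^sub>R cis (- (- t * u))))"
    unfolding fourier_def by (rule integral_norm_bound)
  also have "\<dots> = (LINT u|lborel. gexp (a + 2) u)"
    by (simp add: gexp_def)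
  finally have "norm (Gamma z) * (1 + t\<^sup>2) \<le> (LINT u|lborel. gexp (a + 2) u)"
    unfolding mult.assoc[symmetric] by (simp add: mult.commute[of "norm _"])
  moreover have "1 + t\<^sup>2 > 0" by (simp add: add_pos_nonneg)
  ultimately show ?thesis by (simp add: z_def pos_le_divide_eq)
qed

lemma fourier_measurable [measurable]:
  assumes [measurable]: "g \<in> borel_measurable borel"
  shows "fourier g \<in> borel_measurable borel"
  unfolding fourier_def by measurable

text \<open>The quadratic decay of a single Gamma factor suffices, as the transform of
  \<open>g\<close> is bounded by the L1 norm of \<open>g\<close>.\<close>

lemma integrable_fourier_conv_gexp:
  assumes g: "tame g" and a: "a \<ge> 1"
  shows "integrable lborel (fourier (conv g (gexp a)))"
proof -
  note [measurable] = tameD(3)[OF tame_conv[OF g tame_gexp]]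
  have a0: "a > 0" using a by simp
  define C where "C = (LINT u|lborel. \<bar>g u\<bar>) * (LINT u|lborel. gexp (a + 2) u)"
  have C: "C \<ge> 0" unfolding C_def by (intro mult_nonneg_nonneg integral_nonneg_AE) (auto simp: gexp_def)
  have "integrable lborel (\<lambda>x::real. inverse (1 + x\<^sup>2))"
    using integrable_inverse_1_plus_square by (simp add: set_integrable_def einterval_eq)
  then have "integrable lborel (\<lambda>x::real. C * inverse (1 + x\<^sup>2))" by simp
  then show ?thesis
  proof (rule Bochner_Integration.integrable_bound)
    show "fourier (conv g (gexp a)) \<in> borel_measurable lborel" using a0 by measurable
    show "AE t in lborel. norm (fourier (conv g (gexp a)) t) \<le> norm (C * inverse (1 + t\<^sup>2))"
    proof (intro AE_I2)
      fix t :: real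
      have "norm (fourier g t) \<le> (LINT u|lborel. norm (g u *\<^sub>R cis (- (t * u))))"
        unfolding fourier_def by (rule integral_norm_bound)
      then have 1: "norm (fourier g t) \<le> (LINT u|lborel. \<bar>g u\<bar>)" by simp
      have "norm (fourier (conv g (gexp a)) t) = norm (fourier g t) * norm (Gamma (Complex a (- t)))"
        using a0 by (simp add: fourier_conv g tame_gexp fourier_gexp norm_mult)
      also have "\<dots> \<le> (LINT u|lborel. \<bar>g u\<bar>) * ((LINT u|lborel. gexp (a + 2) u) / (1 + (- t)\<^sup>2))"
        by (intro mult_mono 1 norm_Gamma_le a) auto
      also have "\<dots> = C * inverse (1 + t\<^sup>2)" by (simp add: C_def divide_inverse)
      also have "\<dots> \<le> norm (C * inverse (1 + t\<^sup>2))" by simp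
      finally show "norm (fourier (conv g (gexp a)) t) \<le> norm (C * inverse (1 + t\<^sup>2))" .
    qed
  qed
qed

lemma integrable_conv_integrand:
  assumes g: "tame g" and h: "tame h"
  shows "integrable lborel (\<lambda>u. g u * h (v - u))"
proof -
  note [measurable] = tameD(3)[OF h]
  obtain B where B: "\<And>u. \<bar>h u\<bar> \<le> B" using tame_bound[OF h] by blast
  show ?thesis
    using integrable_scaleR_bounded[OF tameD(1)[OF g], of "\<lambda>u. h (v - u)" B] B by simp
qed

text \<open>On s = c + i t, Gamma(b - s) is the transform of \<open>gexp (b - c)\<close> and x^s is
  \<open>exp (c * v) * cis (t * v)\<close>, so the contour integral is an inverse transform of a
  product. Every \<open>b - c\<close> is at least 1, as the decay estimate requires. The pairing b3
  with b1 and b4 with b2 is the one whose differences later equal m and n.\<close>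

lemma meijerG_eq_conv:
  fixes b1 b2 b3 b4 v :: real
  defines "c \<equiv> min (min b1 b2) (min b3 b4) - 1"
  shows "meijerG_40_04 (exp v) b1 b2 b3 b4
    = exp (c * v) * conv (conv (gexp (b3 - c)) (gexp (b1 - c))) (conv (gexp (b4 - c)) (gexp (b2 - c))) v"
proof -
  define A where "A = conv (gexp (b3 - c)) (gexp (b1 - c))"
  define B where "B = conv (gexp (b4 - c)) (gexp (b2 - c))"
  have ge: "b1 - c \<ge> 1" "b2 - c \<ge> 1" "b3 - c \<ge> 1" "b4 - c \<ge> 1" unfolding c_def by auto
  then have gt: "b1 - c > 0" "b2 - c > 0" "b3 - c > 0" "b4 - c > 0" by auto
  note tg = gt[THEN tame_gexp] and fg = gt[THEN fourier_gexp]
  have tA: "tame A" and tB: "tame B" unfolding A_def B_def by (intro tame_conv tame_gexp gt)+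
  have tAB: "tame (conv A B)" by (intro tame_conv tA tB)
  have F: "fourier (conv A B) t = Gamma (Complex (b3 - c) (- t)) * Gamma (Complex (b1 - c) (- t))
      * (Gamma (Complex (b4 - c) (- t)) * Gamma (Complex (b2 - c) (- t)))" for t
    unfolding fourier_conv[OF tA tB] unfolding A_def B_def
    by (simp add: fourier_conv tg fg)
  \<comment> \<open>The integrability lemma wants one \<open>gexp\<close> as the last factor. Only
    equality of the transforms is used, so associativity of \<open>conv\<close> need not be
    proved.\<close>
  have F': "fourier (conv A B) = fourier (conv (conv A (gexp (b4 - c))) (gexp (b2 - c)))"
    unfolding F fun_eq_iff
    by (simp add: fourier_conv[OF tame_conv[OF tA tg(4)] tg(2)] fourier_conv[OF tA tg(4)] fg)
       (simp add: A_def fourier_conv tg fg)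
  have iF: "integrable lborel (fourier (conv A B))"
    unfolding F' by (intro integrable_fourier_conv_gexp tame_conv tA tame_gexp gt ge)
  note [measurable] = tameD(3)[OF tAB]
  define f where "f = (\<lambda>t. complex_of_real (exp (c * v)) * (fourier (conv A B) t * cis (t * v)))"
  have "integrable lborel (\<lambda>t. fourier (conv A B) t * cis (t * v))"
    using iF by (rule Bochner_Integration.integrable_bound) (auto simp: norm_mult)
  then have "integrable lborel f" unfolding f_def by simp
  then have "integral UNIV f = (LINT t|lborel. f t)"
    using set_borel_integral_eq_integral(2)[of UNIV f] by (simp add: set_integrable_def set_lebesgue_integral_def)
  also have "\<dots> = of_real (exp (c * v)) * of_real (2 * pi * conv A B v)"
    unfolding f_def by (simp only: integral_mult_right_zero fourier_inversion[OF tAB iF])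
  finally have I: "integral UNIV f = of_real (exp (c * v) * (2 * pi * conv A B v))" by simp
  have f: "f t = (let s = Complex c t in
          Gamma (complex_of_real b1 - s) * Gamma (complex_of_real b2 - s) *
          Gamma (complex_of_real b3 - s) * Gamma (complex_of_real b4 - s) *
          complex_of_real (exp v) powr s)" for t
  proof -
    have 1: "complex_of_real b - Complex c t = Complex (b - c) (- t)" for b
      by (simp add: complex_eq_iff)
    have "complex_of_real (exp v) powr Complex c t = exp (Complex c t * of_real v)"
      by (simp add: powr_def Ln_of_real)
    also have "Complex c t * of_real v = of_real (c * v) + \<i> * of_real (t * v)"
      by (simp add: complex_eq_iff)
    also have "exp \<dots> = of_real (exp (c * v)) * cis (t * v)"
      by (simp only: exp_add exp_of_real cis_conv_exp)
    finally show ?thesis unfolding f_def F Let_def 1 by (simp add: mult_ac)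
  qed
  have "meijerG_40_04 (exp v) b1 b2 b3 b4 = Re (integral UNIV f) / (2 * pi)"
    unfolding meijerG_40_04_def c_def[symmetric] f Let_def by simp
  then show ?thesis unfolding I A_def[symmetric] B_def[symmetric] by simp
qed

section \<open>Bessel functions as convolutions\<close>

text \<open>The point is \<open>exp (r + t) + exp (r - t) = 2 * exp r * cosh t\<close>: centring a
  convolution at half its argument produces the Bessel integrand.\<close>

lemma gexp_mult_reflect:
  assumes "exp r = x / 2"
  shows "gexp (\<nu> + b) (r + t) * gexp b (r - t) = exp ((\<nu> + 2 * b) * r) * (exp (\<nu> * t) * exp (- x * cosh t))"
proof -
  have "exp (r + t) + exp (r - t) = x * cosh t"
    using assms by (simp add: exp_add exp_diff cosh_def exp_minus field_simps)
  then have "(\<nu> + b) * (r + t) - exp (r + t) + (b * (r - t) - exp (r - t))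
      = (\<nu> + 2 * b) * r + (\<nu> * t + - x * cosh t)"
    by (simp add: algebra_simps)
  then show ?thesis by (simp only: gexp_def exp_add[symmetric])
qed

lemma bessel_kernel_integrable:
  fixes x :: real
  assumes "x > 0"
  shows "integrable lborel (\<lambda>t. exp (\<nu> * t) * exp (- x * cosh t))"
proof -
  \<comment> \<open>Keeps both \<open>b\<close> and \<open>\<nu> + b\<close> positive for either
    sign of \<open>\<nu>\<close>, so that the kernels are tame.\<close>
  define b where "b = \<bar>\<nu>\<bar> + 1"
  define r where "r = ln (x / 2)"
  have b: "b > 0" "\<nu> + b > 0" by (auto simp: b_def)
  have er: "exp r = x / 2" using assms by (simp add: r_def)
  have "integrable lborel (\<lambda>u. gexp (\<nu> + b) u * gexp b (2 * r - u))"
    by (intro integrable_conv_integrand tame_gexp b)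
  from lborel_integrable_real_affine[OF this, of 1 r]
  have i: "integrable lborel (\<lambda>t. gexp (\<nu> + b) (r + t) * gexp b (r - t))"
    by (simp add: algebra_simps)
  have eq: "gexp (\<nu> + b) (r + t) * gexp b (r - t) = exp ((\<nu> + 2 * b) * r) * (exp (\<nu> * t) * exp (- x * cosh t))" for t
    by (rule gexp_mult_reflect[OF er])
  show ?thesis using i unfolding eq by simp
qed


lemma exp_mult_cosh_split:
  fixes y :: real
  shows "exp (\<nu> * t) * y + exp ((- \<nu>) * t) * y = 2 * (y * cosh (\<nu> * t))"
proof -
  have "2 * (y * cosh (\<nu> * t)) = y * (exp (\<nu> * t) + exp (- (\<nu> * t)))" by (simp add: cosh_field_def)
  then show ?thesis by (simp add: algebra_simps)
qed

lemma besselK_integrable: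
  fixes x :: real
  assumes "x > 0"
  shows "set_integrable lborel {0..} (\<lambda>t. exp (- x * cosh t) * cosh (\<nu> * t))"
proof -
  have "integrable lborel (\<lambda>t. (exp (\<nu> * t) * exp (- x * cosh t) + exp ((-\<nu>) * t) * exp (- x * cosh t)) / 2)"
    by (intro Bochner_Integration.integrable_divide Bochner_Integration.integrable_add bessel_kernel_integrable assms)
  also have "(\<lambda>t. (exp (\<nu> * t) * exp (- x * cosh t) + exp ((-\<nu>) * t) * exp (- x * cosh t)) / 2)
      = (\<lambda>t. exp (- x * cosh t) * cosh (\<nu> * t))"
    by (simp only: exp_mult_cosh_split) simp
  finally show ?thesis
    unfolding set_integrable_def by (intro integrable_mult_indicator) auto
qed

text \<open>Splitting cosh into exponentials and reflecting one half gives the integral over the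
  whole line; the half-lines overlap only in the null set {0}.\<close>

lemma besselK_eq_LINT:
  assumes "x > 0"
  shows "2 * besselK \<nu> x = (LINT t|lborel. exp (\<nu> * t) * exp (- x * cosh t))"
proof -
  define p where "p = (\<lambda>t. exp (\<nu> * t) * exp (- x * cosh t))"
  have p: "integrable lborel p" unfolding p_def by (rule bessel_kernel_integrable[OF assms])
  then have [measurable]: "p \<in> borel_measurable borel" by (auto dest: borel_measurable_integrable)
  have pm: "integrable lborel (\<lambda>t. p (- t))" using lborel_integrable_real_affine[OF p, of "-1" 0] by simp
  have i: "integrable lborel (\<lambda>t. indicator {0..} t *\<^sub>R p t)" "integrable lborel (\<lambda>t. indicator {0..} t *\<^sub>R p (- t))"
    by (intro integrable_mult_indicator p pm; simp)+
  have i': "integrable lborel (\<lambda>t. indicator {..0} t *\<^sub>R p t)"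
    by (intro integrable_mult_indicator p; simp)
  have "besselK \<nu> x = (LINT t|lborel. indicator {0..} t *\<^sub>R (exp (- x * cosh t) * cosh (\<nu> * t)))"
    unfolding besselK_def
    using set_borel_integral_eq_integral(2)[OF besselK_integrable[OF assms, of \<nu>]] by (simp add: set_lebesgue_integral_def)
  then have "2 * besselK \<nu> x = (LINT t|lborel. 2 * (indicator {0..} t *\<^sub>R (exp (- x * cosh t) * cosh (\<nu> * t))))"
    by simp
  also have "\<dots> = (LINT t|lborel. indicator {0..} t *\<^sub>R p t + indicator {0..} t *\<^sub>R p (- t))"
  proof (intro Bochner_Integration.integral_cong refl)
    fix t
    have "2 * (exp (- x * cosh t) * cosh (\<nu> * t)) = p t + p (- t)"
      using exp_mult_cosh_split[of \<nu> t "exp (- x * cosh t)"] by (simp add: p_def)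
    then show "2 * (indicator {0..} t *\<^sub>R (exp (- x * cosh t) * cosh (\<nu> * t)))
        = indicator {0..} t *\<^sub>R p t + indicator {0..} t *\<^sub>R p (- t)"
      by (simp add: indicator_def)
  qed
  also have "\<dots> = (LINT t|lborel. indicator {0..} t *\<^sub>R p t) + (LINT t|lborel. indicator {0..} t *\<^sub>R p (- t))"
    by (rule Bochner_Integration.integral_add[OF i])
  also have "(LINT t|lborel. indicator {0..} t *\<^sub>R p (- t)) = (LINT t|lborel. indicator {..0} t *\<^sub>R p t)"
    by (subst lborel_integral_real_affine[of "-1" _ 0])
       (auto intro!: Bochner_Integration.integral_cong simp: indicator_def)
  also have "(LINT t|lborel. indicator {0..} t *\<^sub>R p t) + (LINT t|lborel. indicator {..0} t *\<^sub>R p t)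
      = (LINT t|lborel. indicator {0..} t *\<^sub>R p t + indicator {..0} t *\<^sub>R p t)"
    by (rule Bochner_Integration.integral_add[OF i(1) i', symmetric])
  also have "\<dots> = (LINT t|lborel. p t)"
  proof (rule integral_cong_AE)
    show "AE t in lborel. indicator {0..} t *\<^sub>R p t + indicator {..0} t *\<^sub>R p t = p t"
      using AE_lborel_singleton[of 0] by eventually_elim (auto simp: indicator_def)
  qed auto
  finally show ?thesis unfolding p_def .
qed

text \<open>Recentre at u = r + t and apply \<open>gexp_mult_reflect\<close> with
  \<open>\<nu> = a - b\<close>.\<close>

lemma conv_gexp_eq_besselK:
  "conv (gexp a) (gexp b) (2 * r) = 2 * exp ((a + b) * r) * besselK (a - b) (2 * exp r)"
proof -
  have "conv (gexp a) (gexp b) (2 * r) = (LINT t|lborel. gexp a (r + 1 * t) * gexp b (2 * r - (r + 1 * t)))"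
    unfolding conv_def by (subst lborel_integral_real_affine[of 1 _ r]) auto
  also have "\<dots> = (LINT t|lborel. exp ((a + b) * r) * (exp ((a - b) * t) * exp (- (2 * exp r) * cosh t)))"
    using gexp_mult_reflect[of r "2 * exp r" "a - b" b] by (simp add: algebra_simps)
  also have "\<dots> = exp ((a + b) * r) * (2 * besselK (a - b) (2 * exp r))"
    by (simp only: integral_mult_right_zero besselK_eq_LINT zero_less_mult_iff exp_gt_zero zero_less_numeral simp_thms)
  finally show ?thesis by simp
qed

lemma besselK_nonneg:
  assumes "x > 0"
  shows "0 \<le> besselK \<nu> x"
proof -
  have "0 \<le> (LINT t|lborel. exp (\<nu> * t) * exp (- x * cosh t))" by (intro integral_nonneg_AE) auto
  then show ?thesis unfolding besselK_eq_LINT[OF assms, symmetric] by simp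
qed

text \<open>Under the integral the dependence on x is
  \<open>exp (- (\<alpha> * cosh t - \<beta>) * x)\<close>, and
  \<open>\<alpha> * cosh t \<ge> \<alpha> \<ge> \<beta>\<close>.\<close>

lemma besselK_exp_antimono:
  assumes "0 < x" "x \<le> y" and "\<bar>\<beta>\<bar> \<le> \<alpha>" "\<alpha> > 0"
  shows "exp (\<beta> * y) * besselK \<nu> (\<alpha> * y) \<le> exp (\<beta> * x) * besselK \<nu> (\<alpha> * x)"
proof -
  have "(LINT t|lborel. exp (\<beta> * y) * (exp (\<nu> * t) * exp (- (\<alpha> * y) * cosh t)))
      \<le> (LINT t|lborel. exp (\<beta> * x) * (exp (\<nu> * t) * exp (- (\<alpha> * x) * cosh t)))"
  proof (intro integral_mono integrable_mult_right bessel_kernel_integrable)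
    fix t :: real
    have "\<alpha> * 1 \<le> \<alpha> * cosh t" using cosh_real_ge_1 assms by (intro mult_left_mono) auto
    then have "0 \<le> \<alpha> * cosh t - \<beta>" using assms by linarith
    then have "(\<alpha> * cosh t - \<beta>) * x \<le> (\<alpha> * cosh t - \<beta>) * y" using assms by (intro mult_left_mono)
    then show "exp (\<beta> * y) * (exp (\<nu> * t) * exp (- (\<alpha> * y) * cosh t)) \<le> exp (\<beta> * x) * (exp (\<nu> * t) * exp (- (\<alpha> * x) * cosh t))"
      by (simp add: algebra_simps flip: exp_add)
  qed (use assms in auto)
  then have "exp (\<beta> * y) * (2 * besselK \<nu> (\<alpha> * y)) \<le> exp (\<beta> * x) * (2 * besselK \<nu> (\<alpha> * x))"
    using assms by (simp only: integral_mult_right_zero besselK_eq_LINT zero_less_mult_iff simp_thms order.strict_trans2[of 0 x y])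
  then show ?thesis by simp
qed

text \<open>Measurability is inherited from a continuous convolution divided by an
  exponential.\<close>

lemma besselK_exp_measurable [measurable]: "(\<lambda>r. besselK \<nu> (2 * exp r)) \<in> borel_measurable borel"
proof -
  have b: "\<bar>\<nu>\<bar> + 1 > 0" "\<bar>\<nu>\<bar> + 1 + \<nu> > 0" by auto
  note [measurable] = tameD(3)[OF tame_conv[OF tame_gexp[OF b(2)] tame_gexp[OF b(1)]]]
  have "besselK \<nu> (2 * exp r) = conv (gexp (\<bar>\<nu>\<bar> + 1 + \<nu>)) (gexp (\<bar>\<nu>\<bar> + 1)) (2 * r)
      / (2 * exp ((\<bar>\<nu>\<bar> + 1 + \<nu> + (\<bar>\<nu>\<bar> + 1)) * r))" for r
    unfolding conv_gexp_eq_besselK by simp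
  then show ?thesis by simp
qed

text \<open>Substituting u = 2 r in the outer convolution puts both inner ones at arguments of the
  form 2 r. The constant 8 is the Jacobian 2 times a factor 2 from each Bessel identity.\<close>

lemma meijerG_eq_besselK:
  fixes b1 b2 b3 b4 v :: real
  defines "f \<equiv> \<lambda>r. exp ((b1 + b3) * r) * besselK (b3 - b1) (2 * exp r)
      * (exp ((b2 + b4) * (v / 2 - r)) * besselK (b4 - b2) (2 * exp (v / 2 - r)))"
  shows "integrable lborel f" "meijerG_40_04 (exp v) b1 b2 b3 b4 = 8 * (LINT r|lborel. f r)"
proof -
  define c where "c = min (min b1 b2) (min b3 b4) - 1"
  define A where "A = conv (gexp (b3 - c)) (gexp (b1 - c))"
  define B where "B = conv (gexp (b4 - c)) (gexp (b2 - c))"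
  have gt: "b1 - c > 0" "b2 - c > 0" "b3 - c > 0" "b4 - c > 0" unfolding c_def by auto
  have tA: "tame A" and tB: "tame B" unfolding A_def B_def by (intro tame_conv tame_gexp gt)+
  have i: "integrable lborel (\<lambda>u. A u * B (v - u))" by (rule integrable_conv_integrand[OF tA tB])
  \<comment> \<open>The abscissa contributes -2 c r - 2 c (v/2 - r) = -c v to the exponent, which is
    free of \<open>r\<close> and cancels the prefactor \<open>exp (c * v)\<close>.\<close>
  have AB: "A (2 * r) * B (v - 2 * r) = 4 * exp (- c * v) * f r" for r
  proof -
    have "v - 2 * r = 2 * (v / 2 - r)" by simp
    then have "A (2 * r) * B (v - 2 * r) = 4 * (exp ((b3 - c + (b1 - c)) * r) * exp ((b4 - c + (b2 - c)) * (v / 2 - r)))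
        * (besselK (b3 - b1) (2 * exp r) * besselK (b4 - b2) (2 * exp (v / 2 - r)))"
      unfolding A_def B_def by (simp only: conv_gexp_eq_besselK) simp
    also have "exp ((b3 - c + (b1 - c)) * r) * exp ((b4 - c + (b2 - c)) * (v / 2 - r))
        = exp (- c * v) * (exp ((b1 + b3) * r) * exp ((b2 + b4) * (v / 2 - r)))"
      unfolding exp_add[symmetric] by (simp add: field_simps)
    finally show ?thesis unfolding f_def by simp
  qed
  from lborel_integrable_real_affine[OF i, of 2 0]
  have "integrable lborel (\<lambda>r. 4 * exp (- c * v) * f r)" by (simp add: AB)
  then show "integrable lborel f" by simp
  have "conv A B v = 2 * (LINT r|lborel. A (0 + 2 * r) * B (v - (0 + 2 * r)))"
    unfolding conv_def by (subst lborel_integral_real_affine[of 2 _ 0]) auto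
  also have "\<dots> = 8 * exp (- c * v) * (LINT r|lborel. f r)" by (simp add: AB)
  finally show "meijerG_40_04 (exp v) b1 b2 b3 b4 = 8 * (LINT r|lborel. f r)"
    unfolding meijerG_eq_conv c_def[symmetric] A_def[symmetric] B_def[symmetric]
    by (simp flip: exp_add)
qed

section \<open>Products of independent random variables\<close>

text \<open>For fixed nonzero x substitute z = x y in the inner integral of the joint density, then
  exchange by Tonelli; x = 0 is a null set.\<close>

lemma (in prob_space) distributed_mult_indep:
  fixes X Y :: "'a \<Rightarrow> real" and f g :: "real \<Rightarrow> ennreal"
  assumes X: "distributed M lborel X f" and Y: "distributed M lborel Y g"
    and ind: "indep_var borel X borel Y"
  shows "distributed M lborel (\<lambda>\<omega>. X \<omega> * Y \<omega>)
    (\<lambda>z. \<integral>\<^sup>+x. f x * g (z / x) * ennreal (1 / \<bar>x\<bar>) \<partial>lborel)"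
    (is "distributed M lborel _ ?D")
proof -
  have [measurable]: "f \<in> borel_measurable borel" "g \<in> borel_measurable borel"
    using distributed_borel_measurable[OF X] distributed_borel_measurable[OF Y] by simp_all
  have [measurable]: "X \<in> borel_measurable M" "Y \<in> borel_measurable M"
    using distributed_measurable[OF X] distributed_measurable[OF Y] by simp_all
  have ind': "indep_var lborel X lborel Y"
    using ind unfolding indep_var_eq by simp
  have J: "distributed M (lborel \<Otimes>\<^sub>M lborel) (\<lambda>\<omega>. (X \<omega>, Y \<omega>)) (\<lambda>(x, y). f x * g y)"
    by (rule distributed_joint_indep[OF _ _ X Y ind']) (rule lborel.sigma_finite_measure_axioms)+
  have "distr M lborel (\<lambda>\<omega>. X \<omega> * Y \<omega>) = density lborel ?D"
  proof (rule measure_eqI)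
    fix A assume "A \<in> sets (distr M lborel (\<lambda>\<omega>. X \<omega> * Y \<omega>))"
    then have [measurable]: "A \<in> sets borel" by simp
    have inner: "(\<integral>\<^sup>+y. f x * g y * indicator A (x * y) \<partial>lborel)
        = (\<integral>\<^sup>+z. f x * g (z / x) * ennreal (1 / \<bar>x\<bar>) * indicator A z \<partial>lborel)" if "x \<noteq> 0" for x
    proof -
      have "(\<integral>\<^sup>+y. f x * g y * indicator A (x * y) \<partial>lborel)
          = ennreal \<bar>1 / x\<bar> * (\<integral>\<^sup>+z. f x * g (0 + 1 / x * z) * indicator A (x * (0 + 1 / x * z)) \<partial>lborel)"
        using that by (subst nn_integral_real_affine[where c="1 / x" and t=0]) auto
      also have "\<dots> = (\<integral>\<^sup>+z. ennreal \<bar>1 / x\<bar> * (f x * g (0 + 1 / x * z) * indicator A (x * (0 + 1 / x * z))) \<partial>lborel)"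
        by (rule nn_integral_cmult[symmetric]) measurable
      also have "\<dots> = (\<integral>\<^sup>+z. f x * g (z / x) * ennreal (1 / \<bar>x\<bar>) * indicator A z \<partial>lborel)"
        using that by (intro nn_integral_cong) (simp add: mult_ac)
      finally show ?thesis .
    qed
    have "emeasure (distr M lborel (\<lambda>\<omega>. X \<omega> * Y \<omega>)) A = (\<integral>\<^sup>+z. indicator A z \<partial>distr M lborel (\<lambda>\<omega>. X \<omega> * Y \<omega>))"
      by simp
    also have "\<dots> = (\<integral>\<^sup>+\<omega>. indicator A (X \<omega> * Y \<omega>) \<partial>M)"
      by (rule nn_integral_distr) measurable
    also have "\<dots> = (\<integral>\<^sup>+p. (case p of (x, y) \<Rightarrow> f x * g y) * indicator A (fst p * snd p) \<partial>(lborel \<Otimes>\<^sub>M lborel))"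
      by (subst distributed_nn_integral[OF J]) auto
    also have "\<dots> = (\<integral>\<^sup>+x. \<integral>\<^sup>+y. f x * g y * indicator A (x * y) \<partial>lborel \<partial>lborel)"
      by (subst lborel.nn_integral_fst[symmetric]) auto
    also have "\<dots> = (\<integral>\<^sup>+x. \<integral>\<^sup>+z. f x * g (z / x) * ennreal (1 / \<bar>x\<bar>) * indicator A z \<partial>lborel \<partial>lborel)"
    proof (rule nn_integral_cong_AE)
      show "AE x in lborel. (\<integral>\<^sup>+y. f x * g y * indicator A (x * y) \<partial>lborel)
          = (\<integral>\<^sup>+z. f x * g (z / x) * ennreal (1 / \<bar>x\<bar>) * indicator A z \<partial>lborel)"
        using AE_lborel_singleton[of 0] by eventually_elim (rule inner)
    qed
    also have "\<dots> = (\<integral>\<^sup>+z. \<integral>\<^sup>+x. f x * g (z / x) * ennreal (1 / \<bar>x\<bar>) * indicator A z \<partial>lborel \<partial>lborel)"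
      by (rule lborel_pair.Fubini') measurable
    also have "\<dots> = (\<integral>\<^sup>+z. ?D z * indicator A z \<partial>lborel)"
      by (intro nn_integral_cong nn_integral_multc) measurable
    also have "\<dots> = emeasure (density lborel ?D) A"
      by (rule emeasure_density[symmetric]) auto
    finally show "emeasure (distr M lborel (\<lambda>\<omega>. X \<omega> * Y \<omega>)) A = emeasure (density lborel ?D) A" .
  qed simp
  then show ?thesis unfolding distributed_def by simp
qed

section \<open>Integrals over the half-line\<close>

text \<open>Substitution x = s exp r, whose Jacobian is again \<open>s * exp r\<close>.
  Integrability is assumed only in the logarithmic variable.\<close>

lemma nn_integral_exp_substitution:
  fixes p :: "real \<Rightarrow> real"
  assumes s: "s > 0" and p: "\<And>x. x > 0 \<Longrightarrow> p x \<ge> 0"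
    and i: "integrable lborel (\<lambda>r. p (s * exp r) * (s * exp r))"
  shows "(\<integral>\<^sup>+x. ennreal (p x) * indicator {0<..} x \<partial>lborel) = ennreal (LINT r|lborel. p (s * exp r) * (s * exp r))"
proof -
  define g where "g = (\<lambda>r. s * exp r)"
  define I where "I = (LINT r|lborel. p (g r) * g r)"
  have gpos: "g r > 0" for r using s by (simp add: g_def)
  have range: "range g = {0<..}"
  proof -
    have "x = g (ln (x / s))" if "x > 0" for x using s that by (simp add: g_def)
    then show ?thesis using gpos by (auto simp: image_iff)
  qed
  have iq: "integrable lborel (\<lambda>r. \<bar>g r\<bar> * p (g r))"
    using i s by (simp add: g_def abs_mult mult.commute)
  have "integrable lebesgue (\<lambda>r. \<bar>g r\<bar> * p (g r))"
    using iq by (subst integrable_completion) (auto dest: borel_measurable_integrable)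
  then have ai: "(\<lambda>r. \<bar>g r\<bar> * p (g r)) absolutely_integrable_on UNIV" by (simp add: set_integrable_def)
  have "(\<lambda>r. \<bar>g r\<bar> * p (g r)) \<in> borel_measurable borel" using borel_measurable_integrable[OF iq] by simp
  from absolutely_integrable_UNIV_lborel(2)[OF ai this]
  have "integral UNIV (\<lambda>r. \<bar>g r\<bar> * p (g r)) = I"
    using gpos by (simp add: I_def mult.commute abs_of_pos)
  with ai have "p absolutely_integrable_on range g \<and> integral (range g) p = I"
    by (subst has_absolute_integral_change_of_variables_1'[symmetric, where g'=g])
       (use s in \<open>auto simp: g_def inj_on_def intro!: derivative_eq_intros\<close>)
  then have ap: "p absolutely_integrable_on {0<..}" and ip: "integral {0<..} p = I"
    unfolding range by auto
  \<comment> \<open>The change of variables gives integrability of \<open>p\<close> with respect to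
    the completed measure, so the integral is evaluated there.\<close>
  have "(\<integral>\<^sup>+x. ennreal (p x) * indicator {0<..} x \<partial>lborel) = (\<integral>\<^sup>+x. ennreal (indicator {0<..} x *\<^sub>R p x) \<partial>lebesgue)"
    unfolding nn_integral_completion by (intro nn_integral_cong) (auto simp: indicator_def)
  also have "\<dots> = ennreal (integral\<^sup>L lebesgue (\<lambda>x. indicator {0<..} x *\<^sub>R p x))"
    using ap p by (intro nn_integral_eq_integral AE_I2) (auto simp: set_integrable_def indicator_def)
  also have "integral\<^sup>L lebesgue (\<lambda>x. indicator {0<..} x *\<^sub>R p x) = I"
    using set_lebesgue_integral_eq_integral(2)[OF ap] ip by (simp add: set_lebesgue_integral_def)
  finally show ?thesis unfolding I_def g_def .
qed

lemma nn_integral_fold_pos: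
  fixes h :: "real \<Rightarrow> ennreal"
  assumes [measurable]: "h \<in> borel_measurable borel"
  shows "(\<integral>\<^sup>+x. h x \<partial>lborel) = (\<integral>\<^sup>+x. (h x + h (- x)) * indicator {0<..} x \<partial>lborel)"
proof -
  have "(\<integral>\<^sup>+x. h x \<partial>lborel) = (\<integral>\<^sup>+x. h x * indicator {0<..} x + h x * indicator {..<0} x \<partial>lborel)"
  proof (rule nn_integral_cong_AE)
    show "AE x in lborel. h x = h x * indicator {0<..} x + h x * indicator {..<0} x"
      using AE_lborel_singleton[of 0] by eventually_elim (auto simp: indicator_def)
  qed
  also have "\<dots> = (\<integral>\<^sup>+x. h x * indicator {0<..} x \<partial>lborel) + (\<integral>\<^sup>+x. h x * indicator {..<0} x \<partial>lborel)"
    by (rule nn_integral_add) measurable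
  also have "(\<integral>\<^sup>+x. h x * indicator {..<0} x \<partial>lborel) = (\<integral>\<^sup>+x. h (- x) * indicator {0<..} x \<partial>lborel)"
    by (subst nn_integral_real_affine[where c="-1" and t=0])
       (auto intro!: nn_integral_cong simp: indicator_def)
  also have "(\<integral>\<^sup>+x. h x * indicator {0<..} x \<partial>lborel) + (\<integral>\<^sup>+x. h (- x) * indicator {0<..} x \<partial>lborel)
     = (\<integral>\<^sup>+x. h x * indicator {0<..} x + h (- x) * indicator {0<..} x \<partial>lborel)"
    by (rule nn_integral_add[symmetric]) measurable
  finally show ?thesis by (simp add: distrib_right)
qed

section \<open>The variance-gamma density\<close>

definition vg_norm_const :: "real \<Rightarrow> real \<Rightarrow> real \<Rightarrow> real" where
  "vg_norm_const \<mu> \<alpha> \<beta> = (\<alpha>\<^sup>2 - \<beta>\<^sup>2) powr (\<mu> + 1/2) / (sqrt pi * (2 * \<alpha>) powr \<mu> * Gamma (\<mu> + 1/2))"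

lemma vg_norm_const_pos:
  assumes "\<mu> > -1/2" "\<bar>\<beta>\<bar> < \<alpha>"
  shows "vg_norm_const \<mu> \<alpha> \<beta> > 0"
proof -
  have "\<beta>\<^sup>2 < \<alpha>\<^sup>2" using assms(2) by (metis abs_le_square_iff abs_of_nonneg abs_ge_zero less_le_trans linorder_not_less order_less_imp_le)
  then show ?thesis using assms unfolding vg_norm_const_def by (auto intro!: divide_pos_pos mult_pos_pos)
qed

lemma vg_density_eq:
  "vg_density \<mu> \<alpha> \<beta> x = vg_norm_const \<mu> \<alpha> \<beta> * exp (\<beta> * x) * \<bar>x\<bar> powr \<mu> * besselK \<mu> (\<alpha> * \<bar>x\<bar>)"
  by (simp add: vg_density_def vg_norm_const_def)

lemma vg_density_nonneg:
  assumes "\<mu> > -1/2" "\<bar>\<beta>\<bar> < \<alpha>"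
  shows "vg_density \<mu> \<alpha> \<beta> x \<ge> 0"
proof (cases "x = 0")
  case True
  then show ?thesis by (simp add: vg_density_def)
next
  case False
  then have "\<alpha> * \<bar>x\<bar> > 0" using assms by auto
  from besselK_nonneg[OF this, of \<mu>] show ?thesis
    unfolding vg_density_eq using vg_norm_const_pos[OF assms] by (intro mult_nonneg_nonneg) auto
qed

text \<open>The power contributes \<open>c powr \<mu>\<close>, and the remaining factor decreases by
  \<open>besselK_exp_antimono\<close>. This later carries finiteness of the product density outward
  from 0.\<close>

lemma vg_density_ray_le:
  assumes "\<mu> > -1/2" "\<bar>\<beta>\<bar> < \<alpha>" and c: "c \<ge> 1" and y: "y \<noteq> 0"
  shows "vg_density \<mu> \<alpha> \<beta> (c * y) \<le> c powr \<mu> * vg_density \<mu> \<alpha> \<beta> y"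
proof -
  \<comment> \<open>Absorbing the sign of \<open>y\<close> reduces both rays to positive
    arguments.\<close>
  define \<beta>' where "\<beta>' = \<beta> * sgn y"
  have y': "\<beta> * y = \<beta>' * \<bar>y\<bar>" by (simp add: \<beta>'_def mult.assoc mult_sgn_abs)
  have le: "exp (\<beta>' * (c * \<bar>y\<bar>)) * besselK \<mu> (\<alpha> * (c * \<bar>y\<bar>)) \<le> exp (\<beta>' * \<bar>y\<bar>) * besselK \<mu> (\<alpha> * \<bar>y\<bar>)"
    using assms by (intro besselK_exp_antimono) (auto simp: \<beta>'_def abs_mult abs_sgn_eq mult_right_mono[of 1 c, simplified])
  have "vg_density \<mu> \<alpha> \<beta> (c * y) = vg_norm_const \<mu> \<alpha> \<beta> * (c powr \<mu> * \<bar>y\<bar> powr \<mu>)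
      * (exp (\<beta>' * (c * \<bar>y\<bar>)) * besselK \<mu> (\<alpha> * (c * \<bar>y\<bar>)))"
    using c y' by (simp add: vg_density_eq abs_mult powr_mult mult.left_commute[of _ c])
  also have "\<dots> \<le> vg_norm_const \<mu> \<alpha> \<beta> * (c powr \<mu> * \<bar>y\<bar> powr \<mu>)
      * (exp (\<beta>' * \<bar>y\<bar>) * besselK \<mu> (\<alpha> * \<bar>y\<bar>))"
    using vg_norm_const_pos[OF assms(1,2)] by (intro mult_left_mono le) auto
  also have "\<dots> = c powr \<mu> * vg_density \<mu> \<alpha> \<beta> y"
    by (simp add: vg_density_eq y')
  finally show ?thesis .
qed

text \<open>Splits the constant by origin: the two normalisations, the powers of
  \<open>2 / \<alpha>1\<close> and \<open>2 / \<alpha>2\<close> from rescaling to logarithmic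
  variables, and 1/4 as the 2 of \<open>2 * cosh\<close> over the 8 of
  \<open>meijerG_eq_besselK\<close>.\<close>

lemma vg_prod_const_eq:
  assumes "\<alpha>1 > 0" "\<alpha>2 > 0" "\<bar>\<beta>1\<bar> < \<alpha>1" "\<bar>\<beta>2\<bar> < \<alpha>2"
  shows "vg_prod_const m n \<alpha>1 \<beta>1 \<alpha>2 \<beta>2
    = vg_norm_const m \<alpha>1 \<beta>1 * vg_norm_const n \<alpha>2 \<beta>2 * (2 / \<alpha>1) powr m * (2 / \<alpha>2) powr n / 4"
proof -
  have sq: "sqrt (a\<^sup>2 - b\<^sup>2) powr (2 * k + 1) = (a\<^sup>2 - b\<^sup>2) powr (k + 1/2)" if "\<bar>b\<bar> < a" for a b k :: real
  proof -
    have "b\<^sup>2 \<le> a\<^sup>2" using that by (intro abs_le_square_iff[THEN iffD1]) auto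
    then have "sqrt (a\<^sup>2 - b\<^sup>2) = (a\<^sup>2 - b\<^sup>2) powr (1/2)" by (simp add: powr_half_sqrt)
    then have "sqrt (a\<^sup>2 - b\<^sup>2) powr (2 * k + 1) = (a\<^sup>2 - b\<^sup>2) powr ((1/2) * (2 * k + 1))" by (simp only: powr_powr)
    also have "(1/2) * (2 * k + 1) = k + 1/2" by (simp add: field_simps)
    finally show ?thesis .
  qed
  have pw: "(2 / a) powr k / (2 * a) powr k = 1 / a powr (2 * k)" if "a > 0" for a k :: real
  proof -
    have "a powr (2 * k) = a powr k * a powr k" by (simp flip: powr_add)
    then show ?thesis using that by (simp add: powr_mult powr_divide)
  qed
  have "vg_norm_const m \<alpha>1 \<beta>1 * vg_norm_const n \<alpha>2 \<beta>2 * (2 / \<alpha>1) powr m * (2 / \<alpha>2) powr n / 4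
     = ((2 / \<alpha>1) powr m / (2 * \<alpha>1) powr m) * ((2 / \<alpha>2) powr n / (2 * \<alpha>2) powr n)
     * (\<alpha>1\<^sup>2 - \<beta>1\<^sup>2) powr (m + 1/2) * (\<alpha>2\<^sup>2 - \<beta>2\<^sup>2) powr (n + 1/2)
     / (4 * (sqrt pi * sqrt pi) * Gamma (m + 1/2) * Gamma (n + 1/2))"
    unfolding vg_norm_const_def by (simp add: mult_ac)
  also have "\<dots> = vg_prod_const m n \<alpha>1 \<beta>1 \<alpha>2 \<beta>2"
    unfolding vg_prod_const_def pw[OF assms(1)] pw[OF assms(2)] sq[OF assms(3)] sq[OF assms(4)]
    by (simp add: mult_ac)
  finally show ?thesis by simp
qed

lemma besselK_restrict_measurable [measurable]:
  "(\<lambda>x. if x > 0 then besselK \<nu> x else 0) \<in> borel_measurable borel"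
proof -
  have "(\<lambda>x. if x > 0 then besselK \<nu> x else 0) = (\<lambda>x::real. if x > 0 then besselK \<nu> (2 * exp (ln (x / 2))) else 0)"
    by (auto simp: fun_eq_iff)
  moreover have "(\<lambda>x::real. besselK \<nu> (2 * exp (ln (x / 2)))) \<in> borel_measurable borel"
    by (rule measurable_compose[OF _ besselK_exp_measurable]) measurable
  ultimately show ?thesis by simp
qed

lemma cosh_even_sums:
  fixes x :: real
  shows "(\<lambda>i. x ^ (2 * i) / fact (2 * i)) sums cosh x"
proof -
  have "(\<lambda>i. if even i then x ^ i /\<^sub>R fact i else 0) sums cosh x" by (rule cosh_converges)
  moreover have "strict_mono (\<lambda>i::nat. 2 * i)" by (simp add: strict_mono_def)
  ultimately have "(\<lambda>i. if even (2 * i) then x ^ (2 * i) /\<^sub>R fact (2 * i) else 0) sums cosh x"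
    by (subst sums_mono_reindex[of "\<lambda>i. 2 * i" "\<lambda>i. if even i then x ^ i /\<^sub>R fact i else 0"]) (auto elim!: evenE)
  then show ?thesis by (simp add: divide_inverse mult.commute)
qed

section \<open>The product of two variance-gamma variables\<close>

text \<open>For x > 0, the integrand of the product density without its exponential factor and
  normalising constants.\<close>

definition vg_prod_kernel :: "real \<Rightarrow> real \<Rightarrow> real \<Rightarrow> real \<Rightarrow> real \<Rightarrow> real \<Rightarrow> real" where
  "vg_prod_kernel m n \<alpha>1 \<alpha>2 z x =
     x powr m * besselK m (\<alpha>1 * x) * ((\<bar>z\<bar> / x) powr n * besselK n (\<alpha>2 * (\<bar>z\<bar> / x))) / x"

lemma binomial_fact_expand:
  fixes x y :: real
  shows "(x + y) ^ N / fact N = (\<Sum>j=0..N. x ^ j * y ^ (N - j) / (fact j * fact (N - j)))"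
proof -
  have "(x + y) ^ N = (\<Sum>j\<le>N. of_nat (N choose j) * x ^ j * y ^ (N - j))" by (rule binomial_ring)
  also have "\<dots> = (\<Sum>j=0..N. fact N * (x ^ j * y ^ (N - j) / (fact j * fact (N - j))))"
    unfolding atMost_atLeast0 by (intro sum.cong refl) (simp add: binomial_fact)
  also have "\<dots> = fact N * (\<Sum>j=0..N. x ^ j * y ^ (N - j) / (fact j * fact (N - j)))"
    by (rule sum_distrib_left[symmetric])
  finally show ?thesis by simp
qed

text \<open>\<open>p i\<close> is the i-th term of the series for \<open>2 * cosh\<close>, times the
  kernel. With x = (2/\<alpha>1) exp r the kernel becomes two Bessel functions at
  \<open>2 * exp r\<close> and \<open>2 * exp (v / 2 - r)\<close>, and each binomial term only
  shifts the exponents, giving one G-function. Nonnegativity comes from the even power; single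
  summands over j may be negative.\<close>

lemma vg_prod_kernel_moment:
  fixes m n \<alpha>1 \<alpha>2 \<beta>1 \<beta>2 z :: real
  assumes \<alpha>: "\<alpha>1 > 0" "\<alpha>2 > 0" and z: "z \<noteq> 0"
  defines "p \<equiv> \<lambda>i x. vg_prod_kernel m n \<alpha>1 \<alpha>2 z x * (2 * ((\<beta>1 * x + \<beta>2 * (z / x)) ^ (2 * i) / fact (2 * i)))"
  shows "(\<integral>\<^sup>+x. ennreal (p i x) * indicator {0<..} x \<partial>lborel)
    = ennreal ((2 / \<alpha>1) powr m * (2 / \<alpha>2) powr n / 4 * vg_prod_term m n \<alpha>1 \<beta>1 \<alpha>2 \<beta>2 z i)" (is ?nn)
    and "0 \<le> vg_prod_term m n \<alpha>1 \<beta>1 \<alpha>2 \<beta>2 z i" (is ?nonneg)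
proof -
  \<comment> \<open>Scales chosen so that both Bessel arguments become 2 times an exponential; then
    \<open>\<bar>z\<bar> = s * s' * exp (v / 2)\<close>, where \<open>exp v\<close> is the argument
    of G.\<close>
  define s where "s = 2 / \<alpha>1"
  define s' where "s' = 2 / \<alpha>2"
  define w where "w = \<alpha>1\<^sup>2 * \<alpha>2\<^sup>2 / 16 * z\<^sup>2"
  define v where "v = ln w"
  have s: "s > 0" "s' > 0" using \<alpha> by (auto simp: s_def s'_def)
  have w: "w > 0" using \<alpha> z by (simp add: w_def)
  then have ev: "exp v = w" by (simp add: v_def)
  have "w = (\<alpha>1 * \<alpha>2 * \<bar>z\<bar> / 4)\<^sup>2" by (simp add: w_def power_mult_distrib power_divide)
  then have "sqrt w = \<alpha>1 * \<alpha>2 * \<bar>z\<bar> / 4" using \<alpha> by simp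
  moreover have "exp (v / 2) = sqrt w"
    by (rule real_sqrt_unique[symmetric]) (auto simp: ev simp flip: exp_of_nat_mult)
  ultimately have az: "\<bar>z\<bar> = s * s' * exp (v / 2)" using \<alpha> by (simp add: s_def s'_def field_simps)
  have zx: "\<bar>z\<bar> / (s * exp r) = s' * exp (v / 2 - r)" for r
    using s by (simp add: az exp_diff)
  have zx': "z / (s * exp r) = sgn z * (s' * exp (v / 2 - r))" for r
    using zx[of r] by (metis mult_sgn_abs mult.commute times_divide_eq_right)
  \<comment> \<open>The integrand of \<open>meijerG_eq_besselK\<close> for the parameters in the
    series. The orders b3 - b1 = m and b4 - b2 = n do not depend on j, while the exponents b1 + b3 =
    m + j and b2 + b4 = n + 2 i - j carry the monomial.\<close>
  define f where "f = (\<lambda>j r. exp ((real j / 2 + (m + real j / 2)) * r) * besselK (m + real j / 2 - real j / 2) (2 * exp r)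
      * (exp ((real i - real j / 2 + (n + real i - real j / 2)) * (v / 2 - r))
        * besselK (n + real i - real j / 2 - (real i - real j / 2)) (2 * exp (v / 2 - r))))"
  define e where "e = (\<lambda>j. (sgn z) ^ j / (fact j * fact (2*i - j))
        * (2 * \<beta>1 / \<alpha>1) ^ j * (2 * \<beta>2 / \<alpha>2) ^ (2*i - j))"
  define C where "C = (2 / \<alpha>1) powr m * (2 / \<alpha>2) powr n"
  have C: "C > 0" using \<alpha> by (simp add: C_def)
  have fi: "integrable lborel (f j)" for j unfolding f_def by (rule meijerG_eq_besselK(1))
  have fG: "8 * (LINT r|lborel. f j r) = meijerG_40_04 w (real j / 2) (real i - real j / 2) (m + real j / 2) (n + real i - real j / 2)" for j
    unfolding f_def ev[symmetric] by (rule meijerG_eq_besselK(2)[symmetric])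
  have f_eq: "f j r = exp (m * r) * besselK m (2 * exp r) * (exp (n * (v / 2 - r)) * besselK n (2 * exp (v / 2 - r)))
      * (exp r ^ j * exp (v / 2 - r) ^ (2 * i - j))" if "j \<in> {0..2*i}" for j r
  proof -
    have 1: "exp r ^ j = exp (real j * r)" "exp (v / 2 - r) ^ (2 * i - j) = exp (real (2 * i - j) * (v / 2 - r))"
      by (simp_all add: exp_of_nat_mult)
    have 2: "(real j / 2 + (m + real j / 2)) * r = m * r + real j * r"
      by (simp add: field_simps)
    have 3: "(real i - real j / 2 + (n + real i - real j / 2)) * (v / 2 - r) = n * (v / 2 - r) + real (2 * i - j) * (v / 2 - r)"
      using that by (simp add: of_nat_diff field_simps)
    have 4: "m + real j / 2 - real j / 2 = m" "n + real i - real j / 2 - (real i - real j / 2) = n" by auto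
    show ?thesis unfolding f_def 1 2 3 4 exp_add by (simp only: mult_ac)
  qed
  have k_eq: "vg_prod_kernel m n \<alpha>1 \<alpha>2 z (s * exp r) * (s * exp r)
      = C * (exp (m * r) * besselK m (2 * exp r) * (exp (n * (v / 2 - r)) * besselK n (2 * exp (v / 2 - r))))" for r
  proof -
    have 1: "(s * exp r) powr m = s powr m * exp (m * r)" "(s' * exp (v / 2 - r)) powr n = s' powr n * exp (n * (v / 2 - r))"
      using s by (simp_all add: powr_mult powr_def[of "exp _"])
    have 2: "\<alpha>1 * (s * exp r) = 2 * exp r" "\<alpha>2 * (s' * exp (v / 2 - r)) = 2 * exp (v / 2 - r)"
      using \<alpha> by (simp_all add: s_def s'_def)
    have 3: "s * exp r \<noteq> 0" using s by simp
    show ?thesis unfolding vg_prod_kernel_def zx 2 1 using 3 by (simp add: C_def s_def s'_def mult_ac)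
  qed
  have pow_eq: "2 * ((\<beta>1 * (s * exp r) + \<beta>2 * (z / (s * exp r))) ^ (2 * i) / fact (2 * i))
      = (\<Sum>j=0..2*i. 2 * e j * (exp r ^ j * exp (v / 2 - r) ^ (2 * i - j)))" for r
  proof -
    \<comment> \<open>The sign enters through z/x with exponent 2 i - j, which has the parity of
      j.\<close>
    have sg: "sgn z ^ (2 * i - j) = sgn z ^ j" if "j \<in> {0..2*i}" for j
    proof -
      have "sgn z ^ 2 = 1" using z by (simp add: sgn_if)
      have "sgn z ^ (2 * i - j) * sgn z ^ j = (sgn z ^ 2) ^ i" using that by (simp flip: power_add power_mult)
      then have "sgn z ^ (2 * i - j) * sgn z ^ j = 1" by (simp add: \<open>sgn z ^ 2 = 1\<close>)
      moreover have "sgn z ^ j * sgn z ^ j = (sgn z ^ 2) ^ j"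
        by (metis power_mult_distrib power2_eq_square)
      then have "sgn z ^ j * sgn z ^ j = 1" by (simp add: \<open>sgn z ^ 2 = 1\<close>)
      ultimately show ?thesis by (metis mult.assoc mult.right_neutral mult.commute)
    qed
    have t: "2 * ((\<beta>1 * (s * exp r)) ^ j * (\<beta>2 * (sgn z * (s' * exp (v / 2 - r)))) ^ (2 * i - j) / (fact j * fact (2 * i - j)))
        = 2 * e j * (exp r ^ j * exp (v / 2 - r) ^ (2 * i - j))" if "j \<in> {0..2*i}" for j
    proof -
      have 1: "2 * \<beta>1 / \<alpha>1 = \<beta>1 * s" "2 * \<beta>2 / \<alpha>2 = \<beta>2 * s'" by (simp_all add: s_def s'_def)
      show ?thesis unfolding e_def 1 power_mult_distrib sg[OF that] by (simp add: mult_ac)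
    qed
    show ?thesis unfolding zx' binomial_fact_expand sum_distrib_left
      by (intro sum.cong refl t)
  qed
  define q where "q = (\<lambda>r. p i (s * exp r) * (s * exp r))"
  have q: "q r = (\<Sum>j=0..2*i. 2 * C * e j * f j r)" for r
  proof -
    have "q r = (vg_prod_kernel m n \<alpha>1 \<alpha>2 z (s * exp r) * (s * exp r))
        * (2 * ((\<beta>1 * (s * exp r) + \<beta>2 * (z / (s * exp r))) ^ (2 * i) / fact (2 * i)))"
      unfolding q_def p_def by (simp only: mult_ac)
    also have "\<dots> = (\<Sum>j=0..2*i. 2 * C * e j * f j r)"
      unfolding k_eq pow_eq sum_distrib_left
      by (intro sum.cong refl) (simp add: f_eq mult_ac)
    finally show ?thesis .
  qed
  have iq: "integrable lborel q"
    unfolding q by (intro Bochner_Integration.integrable_sum integrable_mult_right fi)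
  have "(LINT r|lborel. q r) = (\<Sum>j=0..2*i. 2 * C * e j * (LINT r|lborel. f j r))"
    unfolding q by (subst Bochner_Integration.integral_sum) (auto intro: fi)
  also have "\<dots> = (\<Sum>j=0..2*i. C / 4 * (e j * (8 * (LINT r|lborel. f j r))))"
    by (intro sum.cong refl) simp
  also have "\<dots> = C / 4 * vg_prod_term m n \<alpha>1 \<beta>1 \<alpha>2 \<beta>2 z i"
    unfolding fG vg_prod_term_def e_def w_def by (simp only: sum_distrib_left)
  finally have Iq: "(LINT r|lborel. q r) = C / 4 * vg_prod_term m n \<alpha>1 \<beta>1 \<alpha>2 \<beta>2 z i" .
  have p0: "p i x \<ge> 0" if "x > 0" for x
  proof -
    have "\<alpha>1 * x > 0" "\<alpha>2 * (\<bar>z\<bar> / x) > 0" using that \<alpha> z by auto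
    then show ?thesis unfolding p_def vg_prod_kernel_def using that
      by (intro mult_nonneg_nonneg divide_nonneg_nonneg besselK_nonneg)
         (auto simp: zero_le_even_power)
  qed
  have "0 \<le> (LINT r|lborel. q r)"
    unfolding q_def using s p0 by (intro integral_nonneg_AE AE_I2 mult_nonneg_nonneg) auto
  then show ?nonneg unfolding Iq using C by (simp add: zero_le_mult_iff)
  show ?nn
    using nn_integral_exp_substitution[OF s(1) p0 iq[unfolded q_def]]
    unfolding Iq[unfolded q_def] C_def .
qed

lemma vg_prod_kernel_measurable [measurable]:
  assumes "\<alpha>1 > 0" "\<alpha>2 > 0" "z \<noteq> 0"
  shows "(\<lambda>x. indicator {0<..} x * vg_prod_kernel m n \<alpha>1 \<alpha>2 z x) \<in> borel_measurable borel"
proof -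
  define bk where "bk = (\<lambda>\<nu> x::real. if x > 0 then besselK \<nu> x else 0)"
  have [measurable]: "bk \<nu> \<in> borel_measurable borel" for \<nu>
    unfolding bk_def by (rule besselK_restrict_measurable)
  have "indicator {0<..} x * vg_prod_kernel m n \<alpha>1 \<alpha>2 z x
      = indicator {0<..} x * (x powr m * bk m (\<alpha>1 * x) * ((\<bar>z\<bar> / x) powr n * bk n (\<alpha>2 * (\<bar>z\<bar> / x))) / x)" for x
    using assms by (cases "x > 0") (auto simp: vg_prod_kernel_def bk_def)
  moreover have "(\<lambda>x. indicator {0<..} x * (x powr m * bk m (\<alpha>1 * x) * ((\<bar>z\<bar> / x) powr n * bk n (\<alpha>2 * (\<bar>z\<bar> / x))) / x)) \<in> borel_measurable borel"
    by measurable
  ultimately show ?thesis by simp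
qed

text \<open>An identity in [0, \<infinity>]: all terms are nonnegative, so sum and integral commute
  with no convergence claim, which is settled separately.\<close>

lemma nn_integral_vg_prod:
  fixes m n \<alpha>1 \<alpha>2 \<beta>1 \<beta>2 z :: real
  assumes mn: "m > -1/2" "n > -1/2" and \<alpha>: "\<alpha>1 > 0" "\<alpha>2 > 0" and \<beta>: "\<bar>\<beta>1\<bar> < \<alpha>1" "\<bar>\<beta>2\<bar> < \<alpha>2"
    and z: "z \<noteq> 0"
    and [measurable]: "(\<lambda>x. ennreal (vg_density m \<alpha>1 \<beta>1 x)) \<in> borel_measurable borel"
      "(\<lambda>x. ennreal (vg_density n \<alpha>2 \<beta>2 x)) \<in> borel_measurable borel"
  shows "(\<integral>\<^sup>+x. ennreal (vg_density m \<alpha>1 \<beta>1 x) * ennreal (vg_density n \<alpha>2 \<beta>2 (z / x)) * ennreal (1 / \<bar>x\<bar>) \<partial>lborel)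
    = (\<Sum>i. ennreal (vg_prod_const m n \<alpha>1 \<beta>1 \<alpha>2 \<beta>2 * vg_prod_term m n \<alpha>1 \<beta>1 \<alpha>2 \<beta>2 z i))"
proof -
  define N where "N = vg_norm_const m \<alpha>1 \<beta>1 * vg_norm_const n \<alpha>2 \<beta>2"
  have N: "N > 0" unfolding N_def using vg_norm_const_pos[OF mn(1) \<beta>(1)] vg_norm_const_pos[OF mn(2) \<beta>(2)] by simp
  define h where "h = (\<lambda>x. ennreal (vg_density m \<alpha>1 \<beta>1 x) * ennreal (vg_density n \<alpha>2 \<beta>2 (z / x)) * ennreal (1 / \<bar>x\<bar>))"
  have [measurable]: "h \<in> borel_measurable borel" unfolding h_def by measurable
  define k where "k = vg_prod_kernel m n \<alpha>1 \<alpha>2 z"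
  have km [measurable]: "(\<lambda>x. indicator {0<..} x * k x) \<in> borel_measurable borel"
    unfolding k_def by (rule vg_prod_kernel_measurable[OF \<alpha> z])
  have k0: "k x \<ge> 0" if "x > 0" for x
  proof -
    have "\<alpha>1 * x > 0" "\<alpha>2 * (\<bar>z\<bar> / x) > 0" using that \<alpha> z by auto
    then show ?thesis unfolding k_def vg_prod_kernel_def using that
      by (intro mult_nonneg_nonneg divide_nonneg_nonneg besselK_nonneg) auto
  qed
  define p where "p = (\<lambda>i x. k x * (2 * ((\<beta>1 * x + \<beta>2 * (z / x)) ^ (2 * i) / fact (2 * i))))"
  have p0: "p i x \<ge> 0" if "x > 0" for i x
    unfolding p_def using k0[OF that] by (intro mult_nonneg_nonneg divide_nonneg_nonneg) (auto simp: zero_le_even_power)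
  \<comment> \<open>The sign of x survives only in the exponential, so adding x and -x gives a
    hyperbolic cosine.\<close>
  have hx: "h x = ennreal (N * (k \<bar>x\<bar> * exp (\<beta>1 * x + \<beta>2 * (z / x))))" if "x \<noteq> 0" for x
  proof -
    have "vg_density m \<alpha>1 \<beta>1 x * vg_density n \<alpha>2 \<beta>2 (z / x) * (1 / \<bar>x\<bar>) = N * (k \<bar>x\<bar> * exp (\<beta>1 * x + \<beta>2 * (z / x)))"
      unfolding vg_density_eq N_def k_def vg_prod_kernel_def exp_add abs_divide by (simp add: mult_ac)
    moreover have "h x = ennreal (vg_density m \<alpha>1 \<beta>1 x * vg_density n \<alpha>2 \<beta>2 (z / x) * (1 / \<bar>x\<bar>))"
      unfolding h_def using vg_density_nonneg[OF mn(1) \<beta>(1)] vg_density_nonneg[OF mn(2) \<beta>(2)]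
      by (subst ennreal_mult) (auto simp: ennreal_mult)
    ultimately show ?thesis by simp
  qed
  have fold: "h x + h (- x) = (\<Sum>i. ennreal (N * p i x))" if x: "x > 0" for x
  proof -
    define y where "y = \<beta>1 * x + \<beta>2 * (z / x)"
    have "h x + h (- x) = ennreal (N * (k x * exp y)) + ennreal (N * (k x * exp (- y)))"
      using x by (simp add: hx y_def)
    also have "\<dots> = ennreal (N * (k x * exp y) + N * (k x * exp (- y)))"
      using N k0[OF x] by (intro ennreal_plus[symmetric]) auto
    also have "N * (k x * exp y) + N * (k x * exp (- y)) = N * (k x * (2 * cosh y))"
      by (simp add: cosh_field_def algebra_simps)
    also have "ennreal \<dots> = (\<Sum>i. ennreal (N * p i x))"
      using N k0[OF x] unfolding p_def y_def[symmetric]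
      by (intro suminf_ennreal_eq[symmetric] sums_mult cosh_even_sums mult_nonneg_nonneg divide_nonneg_nonneg) (auto simp: zero_le_even_power)
    finally show ?thesis .
  qed
  have "(\<integral>\<^sup>+x. h x \<partial>lborel) = (\<integral>\<^sup>+x. (h x + h (- x)) * indicator {0<..} x \<partial>lborel)"
    by (rule nn_integral_fold_pos) measurable
  also have "\<dots> = (\<integral>\<^sup>+x. (\<Sum>i. ennreal N * (ennreal (p i x) * indicator {0<..} x)) \<partial>lborel)"
    using N p0 by (intro nn_integral_cong) (auto simp: indicator_def fold ennreal_mult)
  also have "\<dots> = (\<Sum>i. \<integral>\<^sup>+x. ennreal N * (ennreal (p i x) * indicator {0<..} x) \<partial>lborel)"
  proof (rule nn_integral_suminf)
    fix i
    \<comment> \<open>Measurability is available for the kernel cut off to x > 0, so the indicator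
      is moved onto it.\<close>
    have "(\<lambda>x. ennreal N * ennreal ((indicator {0<..} x * k x) * (2 * ((\<beta>1 * x + \<beta>2 * (z / x)) ^ (2 * i) / fact (2 * i))))) \<in> borel_measurable lborel"
      by measurable
    also have "(\<lambda>x. ennreal N * ennreal ((indicator {0<..} x * k x) * (2 * ((\<beta>1 * x + \<beta>2 * (z / x)) ^ (2 * i) / fact (2 * i)))))
        = (\<lambda>x. ennreal N * (ennreal (p i x) * indicator {0<..} x))"
      by (auto simp: fun_eq_iff p_def indicator_def)
    finally show "(\<lambda>x. ennreal N * (ennreal (p i x) * indicator {0<..} x)) \<in> borel_measurable lborel" .
  qed
  also have "\<dots> = (\<Sum>i. ennreal (vg_prod_const m n \<alpha>1 \<beta>1 \<alpha>2 \<beta>2 * vg_prod_term m n \<alpha>1 \<beta>1 \<alpha>2 \<beta>2 z i))"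
  proof (intro suminf_cong)
    fix i
    have "(\<lambda>x. ennreal ((indicator {0<..} x * k x) * (2 * ((\<beta>1 * x + \<beta>2 * (z / x)) ^ (2 * i) / fact (2 * i))))) \<in> borel_measurable lborel"
      by measurable
    also have "(\<lambda>x. ennreal ((indicator {0<..} x * k x) * (2 * ((\<beta>1 * x + \<beta>2 * (z / x)) ^ (2 * i) / fact (2 * i)))))
        = (\<lambda>x. ennreal (p i x) * indicator {0<..} x)"
      by (auto simp: fun_eq_iff p_def indicator_def)
    finally have "(\<integral>\<^sup>+x. ennreal N * (ennreal (p i x) * indicator {0<..} x) \<partial>lborel)
        = ennreal N * (\<integral>\<^sup>+x. ennreal (p i x) * indicator {0<..} x \<partial>lborel)"
      by (rule nn_integral_cmult)
    also have "(\<integral>\<^sup>+x. ennreal (p i x) * indicator {0<..} x \<partial>lborel)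
        = ennreal ((2 / \<alpha>1) powr m * (2 / \<alpha>2) powr n / 4 * vg_prod_term m n \<alpha>1 \<beta>1 \<alpha>2 \<beta>2 z i)"
      unfolding p_def k_def by (rule vg_prod_kernel_moment(1)[OF \<alpha> z])
    also have "ennreal N * \<dots> = ennreal (N * ((2 / \<alpha>1) powr m * (2 / \<alpha>2) powr n / 4 * vg_prod_term m n \<alpha>1 \<beta>1 \<alpha>2 \<beta>2 z i))"
      using N vg_prod_kernel_moment(2)[OF \<alpha> z] by (intro ennreal_mult[symmetric]) auto
    also have "N * ((2 / \<alpha>1) powr m * (2 / \<alpha>2) powr n / 4 * vg_prod_term m n \<alpha>1 \<beta>1 \<alpha>2 \<beta>2 z i)
        = vg_prod_const m n \<alpha>1 \<beta>1 \<alpha>2 \<beta>2 * vg_prod_term m n \<alpha>1 \<beta>1 \<alpha>2 \<beta>2 z i"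
      unfolding vg_prod_const_eq[OF \<alpha> \<beta>] N_def by simp
    finally show "(\<integral>\<^sup>+x. ennreal N * (ennreal (p i x) * indicator {0<..} x) \<partial>lborel)
        = ennreal (vg_prod_const m n \<alpha>1 \<beta>1 \<alpha>2 \<beta>2 * vg_prod_term m n \<alpha>1 \<beta>1 \<alpha>2 \<beta>2 z i)" .
  qed
  finally show ?thesis unfolding h_def .
qed

section \<open>Convergence of the series and the density of the product\<close>

theorem mainTheorem1:
  fixes M :: "'a measure" and X Y :: "'a \<Rightarrow> real"
    and m n \<alpha>1 \<alpha>2 \<beta>1 \<beta>2 :: real
  assumes "prob_space M"
    and "m > -1/2" and "n > -1/2" and "\<alpha>1 > 0" and "\<alpha>2 > 0"
    and "\<bar>\<beta>1\<bar> < \<alpha>1" and "\<bar>\<beta>2\<bar> < \<alpha>2"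
    and "distributed M lborel X (\<lambda>x. ennreal (vg_density m \<alpha>1 \<beta>1 x))"
    and "distributed M lborel Y (\<lambda>y. ennreal (vg_density n \<alpha>2 \<beta>2 y))"
    and "prob_space.indep_var M borel X borel Y"
  shows "(\<forall>z. z \<noteq> 0 \<longrightarrow> summable (vg_prod_term m n \<alpha>1 \<beta>1 \<alpha>2 \<beta>2 z)) \<and>
         distributed M lborel (\<lambda>\<omega>. X \<omega> * Y \<omega>)
           (\<lambda>z. ennreal (if z = 0 then 0 else
              vg_prod_const m n \<alpha>1 \<beta>1 \<alpha>2 \<beta>2 * (\<Sum>i. vg_prod_term m n \<alpha>1 \<beta>1 \<alpha>2 \<beta>2 z i)))"
proof -
  interpret prob_space M by fact
  note par = assms(2-7)
  define f where "f = (\<lambda>x. ennreal (vg_density m \<alpha>1 \<beta>1 x))"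
  define g where "g = (\<lambda>x. ennreal (vg_density n \<alpha>2 \<beta>2 x))"
  define D where "D = (\<lambda>z. \<integral>\<^sup>+x. f x * g (z / x) * ennreal (1 / \<bar>x\<bar>) \<partial>lborel)"
  define C where "C = vg_prod_const m n \<alpha>1 \<beta>1 \<alpha>2 \<beta>2"
  define T where "T = vg_prod_term m n \<alpha>1 \<beta>1 \<alpha>2 \<beta>2"
  have C: "C > 0"
    unfolding C_def vg_prod_const_eq[OF par(3-6)]
    using par vg_norm_const_pos[OF par(1,5)] vg_norm_const_pos[OF par(2,6)] by simp
  have f [measurable]: "f \<in> borel_measurable borel" and g [measurable]: "g \<in> borel_measurable borel"
    using distributed_borel_measurable[OF assms(8)] distributed_borel_measurable[OF assms(9)]
    unfolding f_def g_def by simp_all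
  have DZ: "distributed M lborel (\<lambda>\<omega>. X \<omega> * Y \<omega>) D"
    unfolding D_def f_def g_def by (rule distributed_mult_indep[OF assms(8,9,10)])
  have T0: "0 \<le> T z i" if "z \<noteq> 0" for z i
    unfolding T_def by (rule vg_prod_kernel_moment(2)[OF par(3,4) that])
  have DT: "D z = (\<Sum>i. ennreal (C * T z i))" if "z \<noteq> 0" for z
    unfolding D_def f_def g_def C_def T_def
    by (rule nn_integral_vg_prod[OF par that f[unfolded f_def] g[unfolded g_def]])
  \<comment> \<open>\<open>D\<close> integrates to 1, being the density of a probability
    distribution.\<close>
  have "AE z in lborel. D z \<noteq> \<infinity>"
  proof (rule nn_integral_PInf_AE)
    show D [measurable]: "D \<in> borel_measurable lborel" using distributed_borel_measurable[OF DZ] .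
    have "(\<integral>\<^sup>+z. D z * 1 \<partial>lborel) = (\<integral>\<^sup>+\<omega>. 1 \<partial>M)" by (rule distributed_nn_integral[OF DZ]) simp
    then show "(\<integral>\<^sup>+z. D z \<partial>lborel) \<noteq> \<infinity>" by (simp add: emeasure_space_1)
  qed
  then obtain Q where Q: "{z. D z = \<infinity>} \<subseteq> Q" "Q \<in> null_sets lborel"
    by (auto simp: eventually_ae_filter)
  \<comment> \<open>An interval has positive measure and so cannot lie inside the null set
    \<open>Q\<close>.\<close>
  have ae: "\<exists>w\<in>{a<..<b}. D w \<noteq> \<infinity>" if "a < b" for a b
  proof (rule ccontr)
    assume "\<not> ?thesis"
    then have "{a<..<b} \<subseteq> Q" using Q(1) by auto
    then have "emeasure lborel {a<..<b} \<le> emeasure lborel Q" using Q(2) by (intro emeasure_mono) auto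
    also have "\<dots> = 0" using Q(2) by auto
    finally show False using that by simp
  qed
  \<comment> \<open>\<open>z\<close> enters only through \<open>g (z / x)\<close>, and z/x = c (w/x)
    lies on the same ray as w/x, so the ray estimate applies under the integral. At x = 0 both
    integrands vanish because \<open>1 / 0 = 0\<close>.\<close>
  have mono: "D z \<le> ennreal (c powr n) * D w" if c: "c \<ge> 1" and w: "w \<noteq> 0" and z: "z = c * w" for c z w
  proof -
    have "D z \<le> (\<integral>\<^sup>+x. ennreal (c powr n) * (f x * g (w / x) * ennreal (1 / \<bar>x\<bar>)) \<partial>lborel)"
      unfolding D_def
    proof (intro nn_integral_mono)
      fix x :: real
      show "f x * g (z / x) * ennreal (1 / \<bar>x\<bar>) \<le> ennreal (c powr n) * (f x * g (w / x) * ennreal (1 / \<bar>x\<bar>))"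
      proof (cases "x = 0")
        case False
        then have "g (z / x) \<le> ennreal (c powr n * vg_density n \<alpha>2 \<beta>2 (w / x))"
          unfolding g_def z times_divide_eq_right[symmetric]
          using w by (intro ennreal_leI vg_density_ray_le par c) auto
        also have "\<dots> = ennreal (c powr n) * g (w / x)"
          unfolding g_def by (rule ennreal_mult) (auto intro: vg_density_nonneg par)
        finally have "f x * ennreal (1 / \<bar>x\<bar>) * g (z / x) \<le> f x * ennreal (1 / \<bar>x\<bar>) * (ennreal (c powr n) * g (w / x))"
          by (intro mult_left_mono) auto
        then show ?thesis by (simp only: mult_ac)
      qed simp
    qed
    also have "\<dots> = ennreal (c powr n) * D w" unfolding D_def by (rule nn_integral_cmult) measurable
    finally show ?thesis .
  qed
  have fin: "D z \<noteq> \<infinity>" if z: "z \<noteq> 0" for z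
  proof -
    \<comment> \<open>Take a point \<open>w\<close> of finiteness strictly between 0 and
      \<open>z\<close>; then c = z/w is at least 1.\<close>
    have "\<exists>w c. c \<ge> 1 \<and> w \<noteq> 0 \<and> z = c * w \<and> D w \<noteq> \<infinity>"
    proof (cases "z > 0")
      case True
      with ae[of 0 z] obtain w where "0 < w" "w < z" "D w \<noteq> \<infinity>" by auto
      then show ?thesis by (intro exI[of _ w] exI[of _ "z / w"]) auto
    next
      case False
      with z ae[of z 0] obtain w where "z < w" "w < 0" "D w \<noteq> \<infinity>" by auto
      then show ?thesis by (intro exI[of _ w] exI[of _ "z / w"]) (auto simp: field_simps)
    qed
    then obtain w c where wc: "c \<ge> 1" "w \<noteq> 0" "z = c * w" "D w \<noteq> \<infinity>" by blast
    have "ennreal (c powr n) * D w < \<infinity>" using wc(4) by (simp add: ennreal_mult_less_top less_top)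
    with mono[OF wc(1-3)] show ?thesis by (auto simp: top_unique)
  qed
  have CT0: "0 \<le> C * T z i" if "z \<noteq> 0" for z i using C T0[OF that] by simp
  have sCT: "summable (\<lambda>i. C * T z i)" if z: "z \<noteq> 0" for z
    using fin[OF z] CT0[OF z] unfolding DT[OF z] by (intro summable_suminf_not_top) auto
  have sT: "summable (T z)" if z: "z \<noteq> 0" for z
    using sCT[OF z] C by simp
  have Dval: "D z = ennreal (C * (\<Sum>i. T z i))" if z: "z \<noteq> 0" for z
    unfolding DT[OF z] suminf_ennreal2[OF CT0[OF z] sCT[OF z]] suminf_mult[OF sT[OF z]] ..
  \<comment> \<open>Differs from \<open>D\<close> at most at the single point 0, so it is a density
    of the same distribution.\<close>
  define E where "E = (\<lambda>z. ennreal (if z = 0 then 0 else C * (\<Sum>i. T z i)))"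
  have E_eq: "E = (\<lambda>z. if z = 0 then 0 else D z)" by (auto simp: E_def Dval fun_eq_iff)
  have Dm [measurable]: "D \<in> borel_measurable borel" using distributed_borel_measurable[OF DZ] by simp
  have Em: "E \<in> borel_measurable lborel" unfolding E_eq by measurable
  have "density lborel D = density lborel E"
  proof (rule density_cong)
    show "AE z in lborel. D z = E z"
      using AE_lborel_singleton[of 0] by eventually_elim (simp add: E_eq)
  qed (use Em in auto)
  then have "distributed M lborel (\<lambda>\<omega>. X \<omega> * Y \<omega>) E"
    using DZ Em unfolding distributed_def by simp
  then show ?thesis using sT unfolding E_def C_def T_def by blast
qed

end
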